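(* Let $\Gamma$ be a finitely generated discrete group with finite symmetric generating set $Q$, let $Z\subseteq\mathrm{Sub}(\Gamma)$ be a uniformly recurrent subgroup, and let $H\in Z$. Then the Schreier graph $S_\Gamma^Q(H)$ has local property A if and only if the groupoid $\mathcal{G}_H$ is topologically amenable.
   Context: Word length $l(\gamma)$ is taken with respect to $Q$. $\mathrm{Sub}(\Gamma)$ is the space of subgroups of $\Gamma$ with the topology of pointwise convergence of indicator functions, with $\Gamma$ acting by conjugation. A uniformly recurrent subgroup (URS) is a nonempty closed $\Gamma$-invariant subset $Z\subseteq\mathrm{Sub}(\Gamma)$ on which every $\Gamma$-orbit is dense. The Schreier graph $S=S_\Gamma^Q(H)$ is the rooted labeled graph with vertex set $\Gamma/H$, root $H$, and for each $\gamma H$ and $q\in Q$ an edge from $\gamma H$ to $q\gamma H$ labeled $q$; $d$ is the path metric and $B_n(x)=B_n(S,x)$ the ball of radius $n$ around $x$; root-label isomorphism means graph isomorphism preserving roots and labels. Local property A: $S$ has local property A if there are maps $\rho^n:\Gamma/H\to\ell^2(\Gamma/H)$, $x\mapsto\rho^n_x$ ($n\ge1$), with $\|\rho^n_x\|_2=1$ for all $x$, $\|\rho^n_x-\rho^n_y\|_2\le 1/n$ whenever $d(x,y)\le n$, and each $\rho^n$ local: there is $R_n>0$ such that $\rho^n_x$ is supported in $B_{R_n}(x)$ and whenever $\theta:B_{R_n}(x)\to B_{R_n}(y)$ is a root-label isomorphism (roots $x$, $y$), $\rho^n_y\circ\theta=\rho^n_x$. The groupoid $\mathcal{G}_H$: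 for $p\in\Gamma/H$, $n\ge0$ let $[p]_n$ be the root-label isomorphism class of $(B_n(S,p),p)$; $E_n=\{[p]_n\}$ (finite, discrete) with maps $[p]_{n+1}\mapsto[p]_n$; $\mathcal{G}_H^0=\varprojlim E_n$. For $x=(x_n)\in\mathcal{G}_H^0$ choose $p_n$ with $x_n=[p_n]_n$. Arrows are classes of pairs $(x,\gamma)$, $x\in\mathcal{G}_H^0$, $\gamma\in\Gamma$, with $(x,\gamma)\sim(x,\gamma')$ iff $\gamma p_n=\gamma'p_n$ for all large $n$. Range $r(x,\gamma)=x$, source $\gamma.x$ with $(\gamma.x)_n=[\gamma p_{n+l(\gamma)}]_n$, product $(x,\gamma')(\gamma'.x,\gamma)=(x,\gamma\gamma')$, inverse $(\gamma.x,\gamma^{-1})$, units $(x,e)$. The topology is generated by the sets $\{(x,\gamma): x_N=c\}$ for $N\in\mathbb{N}$, $c\in E_N$, $l(\gamma)\le N$, making $\mathcal{G}_H$ a Hausdorff étale groupoid. Topological amenability is in the sense of Anantharaman-Delaroche and Renault. *)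

theory Defs
  imports "HOL-Analysis.Analysis" "HOL-Algebra.Left_Coset" "HOL-Algebra.Generated_Groups"
begin

definition word_prod :: "'a monoid \<Rightarrow> 'a list \<Rightarrow> 'a" where
  "word_prod G ws = foldr (\<lambda>a b. a \<otimes>\<^bsub>G\<^esub> b) ws \<one>\<^bsub>G\<^esub>"

definition wlen :: "'a monoid \<Rightarrow> 'a set \<Rightarrow> 'a \<Rightarrow> nat" where
  "wlen G Q g = (LEAST n. \<exists>ws. length ws = n \<and> set ws \<subseteq> Q \<and> word_prod G ws = g)"

text \<open>Vertex set Gamma/H of the Schreier graph (left cosets gH).  The labelled edges
  go from a vertex v = gH to q <# v = (q g)H, with label q.\<close>
abbreviation sverts :: "'a monoid \<Rightarrow> 'a set \<Rightarrow> 'a set set" where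
  "sverts G H \<equiv> lcosets\<^bsub>G\<^esub> H"

text \<open>Path metric of the Schreier graph.  Since Q is symmetric, a path of length n from u
  to v corresponds to a word of length n over Q carrying u to v.\<close>
definition sdist :: "'a monoid \<Rightarrow> 'a set \<Rightarrow> 'a set \<Rightarrow> 'a set \<Rightarrow> nat" where
  "sdist G Q u v = (LEAST n. \<exists>ws. length ws = n \<and> set ws \<subseteq> Q \<and> word_prod G ws <#\<^bsub>G\<^esub> u = v)"

definition sball :: "'a monoid \<Rightarrow> 'a set \<Rightarrow> 'a set \<Rightarrow> real \<Rightarrow> 'a set \<Rightarrow> 'a set set" where
  "sball G Q H r x = {v \<in> sverts G H. real (sdist G Q x v) \<le> r}"

text \<open>Root-label isomorphism theta : (B_r(x),x) -> (B_r(y),y) of the balls viewed as labelled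
  (induced) subgraphs of the Schreier graph.\<close>
definition rl_iso :: "'a monoid \<Rightarrow> 'a set \<Rightarrow> 'a set \<Rightarrow> real \<Rightarrow> 'a set \<Rightarrow> 'a set
                       \<Rightarrow> ('a set \<Rightarrow> 'a set) \<Rightarrow> bool" where
  "rl_iso G Q H r x y \<theta> \<longleftrightarrow>
     bij_betw \<theta> (sball G Q H r x) (sball G Q H r y) \<and> \<theta> x = y \<and>
     (\<forall>a\<in>sball G Q H r x. \<forall>b\<in>sball G Q H r x. \<forall>q\<in>Q.
        b = q <#\<^bsub>G\<^esub> a \<longleftrightarrow> \<theta> b = q <#\<^bsub>G\<^esub> \<theta> a)"

definition l2norm :: "('v \<Rightarrow> real) \<Rightarrow> real" where
  "l2norm f = sqrt (\<Sum>\<^sub>\<infinity>v. (f v)\<^sup>2)"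

definition local_property_A :: "'a monoid \<Rightarrow> 'a set \<Rightarrow> 'a set \<Rightarrow> bool" where
  "local_property_A G Q H \<longleftrightarrow>
    (\<exists>\<rho> :: nat \<Rightarrow> 'a set \<Rightarrow> 'a set \<Rightarrow> real.
      \<forall>n\<ge>1.
        (\<forall>x\<in>sverts G H. (\<forall>v. \<rho> n x v \<noteq> 0 \<longrightarrow> v \<in> sverts G H) \<and> l2norm (\<rho> n x) = 1) \<and>
        (\<forall>x\<in>sverts G H. \<forall>y\<in>sverts G H. sdist G Q x y \<le> n \<longrightarrow>
            l2norm (\<lambda>v. \<rho> n x v - \<rho> n y v) \<le> 1 / real n) \<and>
        (\<exists>R::real. R > 0 \<and>
           (\<forall>x\<in>sverts G H. \<forall>v. \<rho> n x v \<noteq> 0 \<longrightarrow> v \<in> sball G Q H R x) \<and>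
           (\<forall>x\<in>sverts G H. \<forall>y\<in>sverts G H. \<forall>\<theta>. rl_iso G Q H R x y \<theta> \<longrightarrow>
               (\<forall>v\<in>sball G Q H R x. \<rho> n y (\<theta> v) = \<rho> n x v))))"

definition ball_class :: "'a monoid \<Rightarrow> 'a set \<Rightarrow> 'a set \<Rightarrow> nat \<Rightarrow> 'a set \<Rightarrow> 'a set set" where
  "ball_class G Q H n p = {p' \<in> sverts G H. \<exists>\<theta>. rl_iso G Q H (real n) p p' \<theta>}"

definition Eclasses :: "'a monoid \<Rightarrow> 'a set \<Rightarrow> 'a set \<Rightarrow> nat \<Rightarrow> 'a set set set" where
  "Eclasses G Q H n = ball_class G Q H n ` sverts G H"

text \<open>Unit space: the inverse limit of the E_n along [p]_{n+1} |-> [p]_n.\<close>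
definition GH0 :: "'a monoid \<Rightarrow> 'a set \<Rightarrow> 'a set \<Rightarrow> (nat \<Rightarrow> 'a set set) set" where
  "GH0 G Q H = {x. \<forall>n. \<exists>p\<in>sverts G H.
       x (Suc n) = ball_class G Q H (Suc n) p \<and> x n = ball_class G Q H n p}"

definition GH0_top :: "'a monoid \<Rightarrow> 'a set \<Rightarrow> 'a set \<Rightarrow> (nat \<Rightarrow> 'a set set) topology" where
  "GH0_top G Q H = subtopology
     (product_topology (\<lambda>n. discrete_topology (Eclasses G Q H n)) UNIV) (GH0 G Q H)"

definition pt :: "(nat \<Rightarrow> 'a set set) \<Rightarrow> nat \<Rightarrow> 'a set" where
  "pt x n = (SOME p. p \<in> x n)"

definition GH_act :: "'a monoid \<Rightarrow> 'a set \<Rightarrow> 'a set \<Rightarrow> 'a \<Rightarrow> (nat \<Rightarrow> 'a set set)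
                      \<Rightarrow> (nat \<Rightarrow> 'a set set)" where
  "GH_act G Q H g x = (\<lambda>n. ball_class G Q H n (g <#\<^bsub>G\<^esub> pt x (n + wlen G Q g)))"

text \<open>Arrows: the class of (x,gamma) is represented by the pair of x and the set of all
  gamma' with (x,gamma) ~ (x,gamma').\<close>
definition GH_arr :: "'a monoid \<Rightarrow> (nat \<Rightarrow> 'a set set) \<Rightarrow> 'a
                      \<Rightarrow> (nat \<Rightarrow> 'a set set) \<times> 'a set" where
  "GH_arr G x g = (x, {g' \<in> carrier G. \<exists>N. \<forall>n\<ge>N. g <#\<^bsub>G\<^esub> pt x n = g' <#\<^bsub>G\<^esub> pt x n})"

definition GH :: "'a monoid \<Rightarrow> 'a set \<Rightarrow> 'a set \<Rightarrow> ((nat \<Rightarrow> 'a set set) \<times> 'a set) set" where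
  "GH G Q H = {GH_arr G x g | x g. x \<in> GH0 G Q H \<and> g \<in> carrier G}"

definition GH_rep :: "(nat \<Rightarrow> 'a set set) \<times> 'a set \<Rightarrow> 'a" where
  "GH_rep a = (SOME g. g \<in> snd a)"

definition GH_r :: "(nat \<Rightarrow> 'a set set) \<times> 'a set \<Rightarrow> (nat \<Rightarrow> 'a set set)" where
  "GH_r a = fst a"

definition GH_s :: "'a monoid \<Rightarrow> 'a set \<Rightarrow> 'a set \<Rightarrow> (nat \<Rightarrow> 'a set set) \<times> 'a set
                    \<Rightarrow> (nat \<Rightarrow> 'a set set)" where
  "GH_s G Q H a = GH_act G Q H (GH_rep a) (fst a)"

definition GH_inv :: "'a monoid \<Rightarrow> 'a set \<Rightarrow> 'a set \<Rightarrow> (nat \<Rightarrow> 'a set set) \<times> 'a set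
                      \<Rightarrow> (nat \<Rightarrow> 'a set set) \<times> 'a set" where
  "GH_inv G Q H a = GH_arr G (GH_s G Q H a) (inv\<^bsub>G\<^esub> (GH_rep a))"

text \<open>Product (x,gamma')(gamma'.x,gamma) = (x, gamma gamma').\<close>
definition GH_mult :: "'a monoid \<Rightarrow> (nat \<Rightarrow> 'a set set) \<times> 'a set \<Rightarrow> (nat \<Rightarrow> 'a set set) \<times> 'a set
                       \<Rightarrow> (nat \<Rightarrow> 'a set set) \<times> 'a set" where
  "GH_mult G a b = GH_arr G (fst a) (GH_rep b \<otimes>\<^bsub>G\<^esub> GH_rep a)"

definition GH_top :: "'a monoid \<Rightarrow> 'a set \<Rightarrow> 'a set \<Rightarrow> ((nat \<Rightarrow> 'a set set) \<times> 'a set) topology" where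
  "GH_top G Q H = topology_generated_by
     {{GH_arr G x g | x. x \<in> GH0 G Q H \<and> x N = c} | N c g.
        c \<in> Eclasses G Q H N \<and> g \<in> carrier G \<and> wlen G Q g \<le> N}"

text \<open>X: unit space with its topology; T: arrow space with its topology; r, s range and source;
  inv, mult the groupoid operations (mult a b defined when s a = r b).  For an etale groupoid the
  range fibres G^x are discrete, so a probability measure m^x on G^x is a nonnegative function
  supported on G^x with total mass 1.  Topological amenability: existence of a continuous
  approximate invariant mean, i.e. a net of continuous systems of probability measures (m^x)
  with sup over gamma in K of || gamma m^{s(gamma)} - m^{r(gamma)} ||_1 tending to 0 for every
  compact K; stated equivalently via all pairs (K, eps).\<close>
definition top_amenable :: "'x topology \<Rightarrow> 'g topology \<Rightarrow> ('g \<Rightarrow> 'x) \<Rightarrow> ('g \<Rightarrow> 'x)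
                            \<Rightarrow> ('g \<Rightarrow> 'g) \<Rightarrow> ('g \<Rightarrow> 'g \<Rightarrow> 'g) \<Rightarrow> bool" where
  "top_amenable X T r s ginv gmult \<longleftrightarrow>
    (\<forall>K \<epsilon>. compactin T K \<and> \<epsilon> > 0 \<longrightarrow>
      (\<exists>m :: 'x \<Rightarrow> 'g \<Rightarrow> real.
         (\<forall>x\<in>topspace X. (\<forall>g. m x g \<ge> 0) \<and>
              (\<forall>g. m x g \<noteq> 0 \<longrightarrow> g \<in> topspace T \<and> r g = x) \<and>
              (m x has_sum 1) {g \<in> topspace T. r g = x}) \<and>
         (\<forall>f. continuous_map T euclideanreal f \<and>
              compactin T (T closure_of {g \<in> topspace T. f g \<noteq> 0}) \<longrightarrow>
              continuous_map X euclideanreal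
                (\<lambda>x. \<Sum>\<^sub>\<infinity>g\<in>{g \<in> topspace T. r g = x}. f g * m x g)) \<and>
         (\<forall>\<gamma>\<in>K. (\<Sum>\<^sub>\<infinity>h\<in>{h \<in> topspace T. r h = r \<gamma>}.
                      \<bar>m (s \<gamma>) (gmult (ginv \<gamma>) h) - m (r \<gamma>) h\<bar>) < \<epsilon>)))"

definition GH_top_amenable :: "'a monoid \<Rightarrow> 'a set \<Rightarrow> 'a set \<Rightarrow> bool" where
  "GH_top_amenable G Q H \<longleftrightarrow>
     top_amenable (GH0_top G Q H) (GH_top G Q H) GH_r (GH_s G Q H) (GH_inv G Q H) (GH_mult G)"

text \<open>Sub(Gamma) with the topology of pointwise convergence of indicator functions.\<close>
definition Sub_top :: "'a monoid \<Rightarrow> 'a set topology" where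
  "Sub_top G = subtopology
     (topology_generated_by ({{K. g \<in> K} | g. g \<in> carrier G} \<union> {{K. g \<notin> K} | g. g \<in> carrier G}))
     {K. subgroup K G}"

definition conj_sub :: "'a monoid \<Rightarrow> 'a \<Rightarrow> 'a set \<Rightarrow> 'a set" where
  "conj_sub G g K = {g \<otimes>\<^bsub>G\<^esub> k \<otimes>\<^bsub>G\<^esub> inv\<^bsub>G\<^esub> g | k. k \<in> K}"

definition is_URS :: "'a monoid \<Rightarrow> 'a set set \<Rightarrow> bool" where
  "is_URS G Z \<longleftrightarrow> Z \<noteq> {} \<and> Z \<subseteq> {K. subgroup K G} \<and> closedin (Sub_top G) Z \<and>
     (\<forall>g\<in>carrier G. \<forall>K\<in>Z. conj_sub G g K \<in> Z) \<and>
     (\<forall>K\<in>Z. Z \<subseteq> (Sub_top G) closure_of ((\<lambda>g. conj_sub G g K) ` carrier G))"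

end

theory Submission
  imports Defs
begin

text \<open>
  Everything is expressed through stabilisers: the \<open>n\<close>-balls around \<open>p\<close> and \<open>p'\<close> are root-label
  isomorphic iff the stabilisers of \<open>p\<close> and \<open>p'\<close> contain the same elements of length at most
  \<open>2n + 1\<close>. Hence a point \<open>x\<close> of the unit space is a subgroup \<open>K\<close> (a limit of conjugates of \<open>H\<close>),
  the arrows with range \<open>x\<close> are the cosets \<open>gK\<close>, and the source of \<open>gK\<close> is \<open>gKg\<inverse>\<close>.

  If the \<open>\<rho>\<close> are as in local property A, locality lets \<open>\<rho>\<^sup>2\<close> descend to a locally constant system
  of finitely supported probability measures on the range fibres, and Cauchy--Schwarz turns the
  \<open>\<ell>\<^sup>2\<close>-variation bound into approximate invariance on the compact sets of arrows of bounded length,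
  which are cofinal among all compact sets. Conversely, the unit space is compact and totally
  disconnected, so a continuous system of measures can be uniformly truncated to bounded length and
  made to depend on finitely many coordinates only; the square roots of the normalised
  densities have small \<open>\<ell>\<^sup>2\<close>-variation because \<open>(\<surd>s - \<surd>t)\<^sup>2 \<le> \<bar>s - t\<bar>\<close>.
\<close>

text \<open>Frees \<open><#\<close> for left cosets, which here also serve as the action of the
  group on vertices.\<close>

no_notation (ASCII) subset_mset (infix \<open><#\<close> 50)

lemma word_prod_Nil [simp]: "word_prod G [] = \<one>\<^bsub>G\<^esub>"
  and word_prod_Cons [simp]: "word_prod G (a # ws) = a \<otimes>\<^bsub>G\<^esub> word_prod G ws"
  by (simp_all add: word_prod_def)

locale schreier = group G for G :: "'a monoid" (structure) +
  fixes Q H :: "'a set"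
  assumes fin: "finite Q" and Q_sub: "Q \<subseteq> carrier G" and Q_inv: "\<forall>q\<in>Q. inv q \<in> Q"
    and gen: "generate G Q = carrier G" and sub: "subgroup H G"
begin

abbreviation V :: "'a set set" where "V \<equiv> lcosets H"

definition wball :: "nat \<Rightarrow> 'a set" where
  "wball n = {g \<in> carrier G. wlen G Q g \<le> n}"

text \<open>For \<open>p = a <# H\<close> this is the conjugate of \<open>H\<close> by
  \<open>a\<close>, so vertices parametrise the conjugates of \<open>H\<close>.\<close>

definition stab :: "'a set \<Rightarrow> 'a set" where
  "stab p = {g \<in> carrier G. g <# p = p}"

subsection \<open>Word balls and stabilisers\<close>

lemma word_closed [intro]: "set ws \<subseteq> Q \<Longrightarrow> word_prod G ws \<in> carrier G"
  using Q_sub by (induction ws) auto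

lemma word_append:
  "set us \<subseteq> Q \<Longrightarrow> set vs \<subseteq> Q \<Longrightarrow> word_prod G (us @ vs) = word_prod G us \<otimes> word_prod G vs"
  using Q_sub by (induction us) (auto simp: m_assoc subset_iff word_closed)

lemma word_inv:
  assumes "set ws \<subseteq> Q"
  shows "\<exists>us. length us = length ws \<and> set us \<subseteq> Q \<and> word_prod G us = inv (word_prod G ws)"
  using assms
proof (induction ws)
  case (Cons a ws)
  then obtain us where us: "length us = length ws" "set us \<subseteq> Q" "word_prod G us = inv (word_prod G ws)"
    by auto
  have "word_prod G (us @ [inv a]) = inv (word_prod G (a # ws))"
    using us Cons.prems Q_sub Q_inv
    by (auto simp: word_append inv_mult_group subset_iff word_closed)
  then show ?case using us Cons.prems Q_inv
    by (intro exI[of _ "us @ [inv a]"]) auto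
qed auto

lemma word_ex:
  assumes "g \<in> carrier G"
  shows "\<exists>ws. set ws \<subseteq> Q \<and> word_prod G ws = g"
proof -
  have "g \<in> generate G Q" using assms gen by simp
  then show ?thesis
  proof (induction rule: generate.induct)
    case one
    show ?case by (rule exI[of _ "[]"]) simp
  next
    case (incl h)
    then show ?case using Q_sub by (intro exI[of _ "[h]"]) auto
  next
    case (inv h)
    then show ?case using Q_sub Q_inv by (intro exI[of _ "[inv h]"]) auto
  next
    case (eng g h)
    then show ?case by (metis word_append set_append Un_subset_iff)
  qed
qed

text \<open>The \<open>LEAST\<close> in \<open>wlen\<close> is attained because \<open>Q\<close>
  generates the group; from here on, length bounds are handled through words. The carrier condition
  in \<open>wball\<close> matters, as \<open>wlen\<close> is unspecified elsewhere.\<close>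

lemma wball_iff:
  "g \<in> wball n \<longleftrightarrow> (\<exists>ws. length ws \<le> n \<and> set ws \<subseteq> Q \<and> word_prod G ws = g)" (is "?l \<longleftrightarrow> ?r")
proof
  assume l: ?l
  then have "\<exists>m ws. length ws = m \<and> set ws \<subseteq> Q \<and> word_prod G ws = g"
    using word_ex by (auto simp: wball_def)
  from LeastI_ex[OF this] obtain ws where "length ws = wlen G Q g" "set ws \<subseteq> Q" "word_prod G ws = g"
    unfolding wlen_def by blast
  moreover have "wlen G Q g \<le> n" using l by (simp add: wball_def)
  ultimately show ?r by (intro exI[of _ ws]) simp
next
  assume ?r
  then obtain ws where ws: "length ws \<le> n" "set ws \<subseteq> Q" "word_prod G ws = g" by auto
  then have "wlen G Q g \<le> length ws" unfolding wlen_def by (intro Least_le) auto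
  with ws show ?l by (auto simp: wball_def)
qed

lemma wball_carrier: "g \<in> wball n \<Longrightarrow> g \<in> carrier G"
  by (simp add: wball_def)

lemma wball_ex: "g \<in> carrier G \<Longrightarrow> g \<in> wball (wlen G Q g)"
  by (simp add: wball_def)

lemma wball_mono: "g \<in> wball m \<Longrightarrow> m \<le> n \<Longrightarrow> g \<in> wball n"
  by (simp add: wball_def)

lemma wball_one: "\<one> \<in> wball n"
  unfolding wball_iff by (rule exI[of _ "[]"]) simp

lemma wball_mult: "g \<in> wball m \<Longrightarrow> h \<in> wball n \<Longrightarrow> g \<otimes> h \<in> wball (m + n)"
  unfolding wball_iff
  by (metis word_append set_append Un_subset_iff length_append add_mono)

lemma wball_inv: "g \<in> wball n \<Longrightarrow> inv g \<in> wball n"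
  unfolding wball_iff by (metis word_inv)

lemma finite_wball: "finite (wball n)"
proof (rule finite_subset)
  show "wball n \<subseteq> word_prod G ` {ws. set ws \<subseteq> Q \<and> length ws \<le> n}"
    by (auto simp: wball_iff)
  show "finite (word_prod G ` {ws. set ws \<subseteq> Q \<and> length ws \<le> n})"
    using finite_lists_length_le[OF fin] by simp
qed

lemma card_wball_pos: "card (wball n) > 0"
  using finite_wball wball_one card_gt_0_iff by blast

text \<open>Cutting the word around its middle letter \<open>q\<close> leaves two pieces of length
  at most \<open>n\<close>; the first is inverted to give \<open>u\<close>. The empty word has no
  middle letter, hence the separate case \<open>\<one>\<close>.\<close>

lemma wball_split:
  assumes "g \<in> wball (2 * n + 1)"
  shows "g = \<one> \<or> (\<exists>u\<in>wball n. \<exists>v\<in>wball n. \<exists>q\<in>Q. g = inv u \<otimes> (q \<otimes> v))"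
proof -
  obtain ws where ws: "length ws \<le> 2 * n + 1" "set ws \<subseteq> Q" "word_prod G ws = g"
    using assms by (auto simp: wball_iff)
  show ?thesis
  proof (cases "ws = []")
    case False
    define k where "k = length ws div 2"
    have k: "k < length ws" "k \<le> n" "length ws - Suc k \<le> n"
      using False ws(1) unfolding k_def by (cases ws; auto; linarith)+
    have eq: "ws = take k ws @ ws ! k # drop (Suc k) ws"
      using k by (simp add: id_take_nth_drop)
    have sets: "set (take k ws) \<subseteq> Q" "set (drop (Suc k) ws) \<subseteq> Q" "ws ! k \<in> Q"
      using ws(2) k by (auto dest: in_set_takeD in_set_dropD)
    define u where "u = inv (word_prod G (take k ws))"
    define v where "v = word_prod G (drop (Suc k) ws)"
    have "word_prod G (take k ws) \<in> wball n" "v \<in> wball n"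
      using sets k unfolding wball_iff v_def by (metis length_take min.coboundedI2 length_drop)+
    moreover from this have "g = inv (inv (word_prod G (take k ws))) \<otimes> (ws ! k \<otimes> v)"
      using ws(3) sets Q_sub by (subst (asm) eq) (auto simp: word_append v_def dest: wball_carrier)
    ultimately show ?thesis using sets wball_inv by blast
  qed (use ws in auto)
qed

section \<open>Action of the group on the vertices, and their stabilisers\<close>

lemma V_carrier: "p \<in> V \<Longrightarrow> p \<subseteq> carrier G"
  using l_coset_subset_G[OF subgroup.subset[OF sub]] by (auto simp: LCOSETS_def)

lemma act_act: "g \<in> carrier G \<Longrightarrow> h \<in> carrier G \<Longrightarrow> p \<in> V \<Longrightarrow> g <# (h <# p) = (g \<otimes> h) <# p"
  by (simp add: lcos_m_assoc V_carrier)

lemma act_V [simp, intro]: "g \<in> carrier G \<Longrightarrow> p \<in> V \<Longrightarrow> g <# p \<in> V"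
  using subgroup.subset[OF sub] by (force simp: LCOSETS_def lcos_m_assoc)

lemma act_one [simp]: "p \<in> V \<Longrightarrow> \<one> <# p = p"
  by (simp add: lcos_mult_one V_carrier)

lemma act_eq_iff:
  assumes "g \<in> carrier G" "h \<in> carrier G" "p \<in> V"
  shows "g <# p = h <# p \<longleftrightarrow> inv g \<otimes> h \<in> stab p"
proof
  assume "g <# p = h <# p"
  then have "inv g <# (g <# p) = inv g <# (h <# p)" by simp
  then show "inv g \<otimes> h \<in> stab p" using assms by (simp add: act_act stab_def)
next
  assume "inv g \<otimes> h \<in> stab p"
  then have "g <# ((inv g \<otimes> h) <# p) = g <# p" by (simp add: stab_def)
  then show "g <# p = h <# p" using assms by (simp add: act_act m_assoc[symmetric])
qed

lemma V_trans:
  assumes "p \<in> V" "q \<in> V"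
  shows "\<exists>g\<in>carrier G. g <# p = q"
proof -
  obtain a b where ab: "a \<in> carrier G" "b \<in> carrier G" "p = a <# H" "q = b <# H"
    using assms by (auto simp: LCOSETS_def)
  then have "(b \<otimes> inv a) <# p = q"
    using subgroup.subset[OF sub] by (simp add: lcos_m_assoc m_assoc)
  then show ?thesis using ab by blast
qed

lemma stab_subgroup:
  assumes "p \<in> V" shows "subgroup (stab p) G"
proof (rule subgroupI)
  show "stab p \<noteq> {}" using assms by (force simp: stab_def)
next
  fix a assume "a \<in> stab p"
  then show "inv a \<in> stab p"
    using assms act_eq_iff[of a \<one> p] by (auto simp: stab_def)
next
  fix a b assume "a \<in> stab p" "b \<in> stab p"
  then show "a \<otimes> b \<in> stab p" using assms by (auto simp: stab_def act_act[symmetric])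
qed (auto simp: stab_def)

lemma stab_act:
  assumes "p \<in> V" "g \<in> carrier G"
  shows "h \<in> stab (g <# p) \<longleftrightarrow> h \<in> carrier G \<and> inv g \<otimes> h \<otimes> g \<in> stab p"
proof (cases "h \<in> carrier G")
  case True
  have "h <# (g <# p) = g <# p \<longleftrightarrow> g <# p = (h \<otimes> g) <# p"
    using True assms by (auto simp: act_act)
  also have "\<dots> \<longleftrightarrow> inv g \<otimes> (h \<otimes> g) \<in> stab p"
    using True assms by (simp add: act_eq_iff)
  finally show ?thesis using True assms by (simp add: stab_def m_assoc)
qed (simp add: stab_def)

section \<open>Balls of the Schreier graph and their root-label isomorphisms\<close>

lemma sdist_le_iff:
  assumes "p \<in> V" "v \<in> V"
  shows "sdist G Q p v \<le> n \<longleftrightarrow> (\<exists>g\<in>wball n. g <# p = v)" (is "?l \<longleftrightarrow> ?r")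
proof
  assume l: ?l
  have "\<exists>m ws. length ws = m \<and> set ws \<subseteq> Q \<and> word_prod G ws <# p = v"
    using V_trans[OF assms] word_ex by metis
  from LeastI_ex[OF this] obtain ws
    where "length ws = sdist G Q p v" "set ws \<subseteq> Q" "word_prod G ws <# p = v"
    unfolding sdist_def by blast
  moreover from this have "word_prod G ws \<in> wball n"
    using l unfolding wball_iff by (intro exI[of _ ws]) simp
  ultimately show ?r by blast
next
  assume ?r
  then obtain ws where ws: "length ws \<le> n" "set ws \<subseteq> Q" "word_prod G ws <# p = v"
    by (auto simp: wball_iff)
  then have "sdist G Q p v \<le> length ws" unfolding sdist_def by (intro Least_le) auto
  with ws show ?l by simp
qed

text \<open>Graph distances are natural numbers, so a real radius counts only through its floor.
  Hence the real locality radius of property A can be handled as a natural number.\<close>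

lemma sball_eq:
  assumes "p \<in> V" "r \<ge> 0"
  shows "sball G Q H r p = (\<lambda>g. g <# p) ` wball (nat \<lfloor>r\<rfloor>)"
proof -
  have "sball G Q H r p = {v \<in> V. sdist G Q p v \<le> nat \<lfloor>r\<rfloor>}"
    unfolding sball_def using assms(2) by (intro Collect_cong conj_cong refl) linarith
  also have "\<dots> = (\<lambda>g. g <# p) ` wball (nat \<lfloor>r\<rfloor>)"
    using assms(1) wball_carrier sdist_le_iff[OF assms(1)] by blast
  finally show ?thesis .
qed

text \<open>The radius \<open>2n + 1\<close> is forced by \<open>wball_split\<close>: the edges of the induced subgraph on the \<open>n\<close>-ball
  produce relators \<open>u\<inverse> q v\<close> with \<open>u\<close>, \<open>v\<close> of length at most \<open>n\<close>.\<close>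

definition agree :: "nat \<Rightarrow> 'a set \<Rightarrow> 'a set \<Rightarrow> bool" where
  "agree n K L \<longleftrightarrow> K \<inter> wball (2 * n + 1) = L \<inter> wball (2 * n + 1)"

text \<open>Every intermediate vertex of the walk spelled by the word is a suffix applied to
  \<open>p\<close>, so it stays in the ball, where \<open>\<theta>\<close> preserves labelled edges.
  Thus \<open>\<theta>\<close> is forced by its value at the root.\<close>

lemma rl_iso_act:
  assumes "p \<in> V" "p' \<in> V" "r \<ge> 0" "rl_iso G Q H r p p' \<theta>" "g \<in> wball (nat \<lfloor>r\<rfloor>)"
  shows "\<theta> (g <# p) = g <# p'"
proof -
  define n where "n = nat \<lfloor>r\<rfloor>"
  have edge: "\<And>a b q. \<lbrakk>a \<in> wball n; b \<in> wball n; q \<in> Q; b <# p = q <# (a <# p)\<rbrakk>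
                 \<Longrightarrow> \<theta> (b <# p) = q <# \<theta> (a <# p)"
    using assms unfolding rl_iso_def n_def by (simp add: sball_eq)
  have "\<theta> (word_prod G ws <# p) = word_prod G ws <# p'" if "length ws \<le> n" "set ws \<subseteq> Q" for ws
    using that
  proof (induction ws)
    case Nil
    then show ?case using assms by (simp add: rl_iso_def)
  next
    case (Cons q ws)
    have q: "q \<in> carrier G" "word_prod G ws \<in> carrier G" using Cons.prems Q_sub by auto
    have "\<theta> (word_prod G (q # ws) <# p) = q <# \<theta> (word_prod G ws <# p)"
    proof (rule edge)
      show "word_prod G ws \<in> wball n"
        unfolding wball_iff using Cons.prems by (intro exI[of _ ws]) simp
      show "word_prod G (q # ws) \<in> wball n"
        unfolding wball_iff using Cons.prems by (intro exI[of _ "q # ws"]) simp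
      show "word_prod G (q # ws) <# p = q <# (word_prod G ws <# p)"
        using q assms by (simp add: act_act)
    qed (use Cons.prems in simp)
    moreover have "\<theta> (word_prod G ws <# p) = word_prod G ws <# p'" using Cons by simp
    ultimately show ?case using q assms by (simp add: act_act)
  qed
  then show ?thesis using assms(5) by (auto simp: wball_iff n_def)
qed

lemma edge_iff:
  assumes "p \<in> V" "u \<in> wball n" "v \<in> wball n" "q \<in> Q"
  shows "u <# p = q <# (v <# p) \<longleftrightarrow> inv u \<otimes> (q \<otimes> v) \<in> stab p"
proof -
  have "u \<in> carrier G" "q \<in> carrier G" "v \<in> carrier G"
    using assms Q_sub by (auto dest: wball_carrier)
  with assms show ?thesis by (simp add: act_act act_eq_iff)
qed

lemma agreeD: "agree n K L \<Longrightarrow> g \<in> wball m \<Longrightarrow> m \<le> 2 * n + 1 \<Longrightarrow> g \<in> K \<longleftrightarrow> g \<in> L"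
  using wball_mono[of g m "2 * n + 1"] unfolding agree_def by auto

text \<open>A coincidence is tested by \<open>inv g \<otimes> h\<close>, of length at most
  \<open>k + l\<close>. Separate bounds \<open>k\<close> and \<open>l\<close> allow a long word to
  be compared with a short one.\<close>

lemma act_eq_agree:
  assumes "agree n (stab p) (stab p')" "p \<in> V" "p' \<in> V" "g \<in> wball k" "h \<in> wball l" "k + l \<le> 2 * n + 1"
  shows "g <# p = h <# p \<longleftrightarrow> g <# p' = h <# p'"
  using assms agreeD[OF assms(1) wball_mult[OF wball_inv[OF assms(4)] assms(5)]]
  by (simp add: act_eq_iff wball_carrier)

text \<open>By \<open>wball_split\<close>, a nontrivial element of length at most
  \<open>2n + 1\<close> fixes \<open>p\<close> exactly when a \<open>q\<close>-edge runs from
  \<open>v <# p\<close> to \<open>u <# p\<close>, and isomorphisms preserve and reflect such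
  edges.\<close>

lemma rl_iso_imp_agree:
  assumes "p \<in> V" "p' \<in> V" "r \<ge> 0" "rl_iso G Q H r p p' \<theta>"
  shows "agree (nat \<lfloor>r\<rfloor>) (stab p) (stab p')"
proof -
  define n where "n = nat \<lfloor>r\<rfloor>"
  have th: "\<And>g. g \<in> wball n \<Longrightarrow> \<theta> (g <# p) = g <# p'"
    using rl_iso_act[OF assms] by (simp add: n_def)
  have "g \<in> stab p \<longleftrightarrow> g \<in> stab p'" if "g \<in> wball (2 * n + 1)" for g
    using wball_split[OF that]
  proof (elim disjE bexE)
    fix u v q assume *: "u \<in> wball n" "v \<in> wball n" "q \<in> Q" "g = inv u \<otimes> (q \<otimes> v)"
    have "u <# p = q <# (v <# p) \<longleftrightarrow> \<theta> (u <# p) = q <# \<theta> (v <# p)"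
      using * assms by (simp add: rl_iso_def sball_eq n_def)
    then show ?thesis using * assms by (simp add: th edge_iff)
  qed (use assms in \<open>simp add: stab_def\<close>)
  then show ?thesis unfolding agree_def n_def by blast
qed

text \<open>The map \<open>g <# p \<mapsto> g <# p'\<close> is well defined and injective because
  coincidences inside the ball are tested by elements of length at most \<open>2n\<close>; edges
  need one letter more.\<close>

lemma agree_imp_rl_iso:
  assumes pp: "p \<in> V" "p' \<in> V" "r \<ge> 0" and ag: "agree (nat \<lfloor>r\<rfloor>) (stab p) (stab p')"
  shows "\<exists>\<theta>. rl_iso G Q H r p p' \<theta>"
proof -
  define n where "n = nat \<lfloor>r\<rfloor>"
  define \<theta> where "\<theta> v = (SOME g. g \<in> wball n \<and> g <# p = v) <# p'" for v
  have eq: "g <# p = h <# p \<longleftrightarrow> g <# p' = h <# p'" if "g \<in> wball n" "h \<in> wball n" for g h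
    using act_eq_agree[OF ag pp(1,2) that] by (simp add: n_def)
  have th: "\<theta> (g <# p) = g <# p'" if "g \<in> wball n" for g
  proof -
    have "\<exists>h. h \<in> wball n \<and> h <# p = g <# p" using that by blast
    from someI_ex[OF this] show ?thesis using eq that unfolding \<theta>_def by blast
  qed
  have "bij_betw \<theta> ((\<lambda>g. g <# p) ` wball n) ((\<lambda>g. g <# p') ` wball n)"
    unfolding bij_betw_def inj_on_def by (auto simp: th eq image_image)
  moreover have "\<theta> p = p'" using th[OF wball_one] pp by simp
  moreover have "u <# p = q <# (v <# p) \<longleftrightarrow> \<theta> (u <# p) = q <# \<theta> (v <# p)"
    if "u \<in> wball n" "v \<in> wball n" "q \<in> Q" for u v q
  proof -
    have "inv u \<otimes> (q \<otimes> v) \<in> wball (n + (1 + n))"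
      using that Q_sub by (intro wball_mult wball_inv) (auto simp: wball_iff intro!: exI[of _ "[q]"])
    then have "inv u \<otimes> (q \<otimes> v) \<in> stab p \<longleftrightarrow> inv u \<otimes> (q \<otimes> v) \<in> stab p'"
      using agreeD[OF ag] by (simp add: n_def)
    then show ?thesis using that pp by (simp add: th edge_iff)
  qed
  ultimately show ?thesis
    using pp by (intro exI[of _ \<theta>]) (auto simp: rl_iso_def sball_eq n_def)
qed

lemma ball_class_eq: "p \<in> V \<Longrightarrow> ball_class G Q H n p = {p' \<in> V. agree n (stab p) (stab p')}"
  unfolding ball_class_def
  using rl_iso_imp_agree[of p _ "real n"] agree_imp_rl_iso[of p _ "real n"] by auto

lemma ball_class_eq_iff:
  "p \<in> V \<Longrightarrow> p' \<in> V \<Longrightarrow> ball_class G Q H n p = ball_class G Q H n p' \<longleftrightarrow> agree n (stab p) (stab p')"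
  by (auto simp: ball_class_eq agree_def)

lemma finite_Eclasses: "finite (Eclasses G Q H n)"
proof (rule finite_subset)
  show "Eclasses G Q H n \<subseteq> (\<lambda>S. {p' \<in> V. S = stab p' \<inter> wball (2 * n + 1)}) ` Pow (wball (2 * n + 1))"
    by (auto simp: Eclasses_def ball_class_eq agree_def image_iff intro!: bexI[of _ "stab _ \<inter> wball (2 * n + 1)"])
qed (simp add: finite_wball)


subsection \<open>Units as limits of stabilisers\<close>

abbreviation X0 :: "(nat \<Rightarrow> 'a set set) set" where "X0 \<equiv> GH0 G Q H"

abbreviation arr :: "(nat \<Rightarrow> 'a set set) \<Rightarrow> 'a \<Rightarrow> (nat \<Rightarrow> 'a set set) \<times> 'a set"
  where "arr \<equiv> GH_arr G"

text \<open>The elements of length at most \<open>2n + 1\<close> of this subgroup are decided by the coordinate \<open>x n\<close>, so the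
  choices made by \<open>pt\<close> do not matter.\<close>

definition lim_stab :: "(nat \<Rightarrow> 'a set set) \<Rightarrow> 'a set" where
  "lim_stab x = {g. \<exists>n. g \<in> wball (2 * n + 1) \<and> g \<in> stab (pt x n)}"

lemma mult_inv_cancel:
  assumes "a \<in> carrier G" "b \<in> carrier G"
  shows "a \<otimes> (inv a \<otimes> b) = b" "inv a \<otimes> (a \<otimes> b) = b"
  using assms by (simp_all add: m_assoc[symmetric])

lemma agree_refl [simp]: "agree n K K"
  and agree_sym: "agree n K L \<Longrightarrow> agree n L K"
  and agree_trans: "agree n K L \<Longrightarrow> agree n L M \<Longrightarrow> agree n K M"
  by (auto simp: agree_def)

lemma agree_iff: "agree n K L \<longleftrightarrow> (\<forall>g\<in>wball (2 * n + 1). g \<in> K \<longleftrightarrow> g \<in> L)"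
  by (auto simp: agree_def)

lemma agree_mono: "agree n K L \<Longrightarrow> m \<le> n \<Longrightarrow> agree m K L"
  unfolding agree_iff by (meson wball_mono add_le_mono1 mult_le_mono2)

lemma carrier_wball: "g \<in> carrier G \<Longrightarrow> \<exists>n. g \<in> wball (2 * n + 1)"
  by (rule exI[of _ "wlen G Q g"]) (simp add: wball_def)

lemma agree_all: "K \<subseteq> carrier G \<Longrightarrow> L \<subseteq> carrier G \<Longrightarrow> (\<And>n. agree n K L) \<Longrightarrow> K = L"
  unfolding agree_iff using carrier_wball by blast

lemma GH0_pt:
  assumes "x \<in> X0"
  shows "pt x n \<in> V" "x n = ball_class G Q H n (pt x n)"
proof -
  obtain p where p: "p \<in> V" "x n = ball_class G Q H n p"
    using assms unfolding GH0_def by blast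
  then have "p \<in> x n" by (simp add: ball_class_eq)
  then have "pt x n \<in> x n" unfolding pt_def by (rule someI)
  then have *: "pt x n \<in> V" "agree n (stab p) (stab (pt x n))" using p by (auto simp: ball_class_eq)
  then show "pt x n \<in> V" "x n = ball_class G Q H n (pt x n)" using p by (auto simp: ball_class_eq_iff)
qed

lemma GH0_agree:
  assumes "x \<in> X0" "m \<le> n"
  shows "agree m (stab (pt x n)) (stab (pt x m))"
  using \<open>m \<le> n\<close>
proof (induction n rule: dec_induct)
  case (step n)
  obtain p where p: "p \<in> V" "x (Suc n) = ball_class G Q H (Suc n) p" "x n = ball_class G Q H n p"
    using assms(1) unfolding GH0_def by blast
  then have "agree n (stab (pt x (Suc n))) (stab p)"
    using GH0_pt[OF assms(1), of "Suc n"] agree_mono[of "Suc n" _ _ n] by (auto simp: ball_class_eq_iff)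
  moreover have "agree n (stab p) (stab (pt x n))"
    using p GH0_pt[OF assms(1), of n] by (auto simp: ball_class_eq_iff intro: agree_sym)
  ultimately have "agree n (stab (pt x (Suc n))) (stab (pt x n))" by (rule agree_trans)
  then show ?case using step agree_mono agree_trans by blast
qed auto

lemma lim_stab_agree:
  assumes "x \<in> X0"
  shows "agree n (lim_stab x) (stab (pt x n))"
  unfolding agree_iff
proof
  fix g assume g: "g \<in> wball (2 * n + 1)"
  have "g \<in> stab (pt x n)" if "g \<in> wball (2 * m + 1)" "g \<in> stab (pt x m)" for m
    using GH0_agree[OF assms, of m n] GH0_agree[OF assms, of n m] that g
    unfolding agree_iff by (cases "m \<le> n") auto
  with g show "g \<in> lim_stab x \<longleftrightarrow> g \<in> stab (pt x n)" unfolding lim_stab_def by blast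
qed

lemma lim_stab_carrier: "lim_stab x \<subseteq> carrier G"
  by (auto simp: lim_stab_def dest: wball_carrier)

text \<open>Membership of \<open>k\<close> is settled from the level that accommodates its length,
  so the clause "for all large n" in the equivalence of arrows becomes membership in
  \<open>lim_stab x\<close>.\<close>

lemma lim_stab_eventually:
  assumes "x \<in> X0" "k \<in> carrier G"
  shows "k \<in> lim_stab x \<longleftrightarrow> (\<exists>N. \<forall>n\<ge>N. k \<in> stab (pt x n))"
proof -
  obtain m where m: "k \<in> wball (2 * m + 1)" using carrier_wball assms by blast
  have *: "k \<in> lim_stab x \<longleftrightarrow> k \<in> stab (pt x n)" if "n \<ge> m" for n
    using agreeD[OF lim_stab_agree[OF assms(1)] m, of n] that by simp
  show ?thesis
  proof
    assume "\<exists>N. \<forall>n\<ge>N. k \<in> stab (pt x n)"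
    then obtain N where "\<forall>n\<ge>N. k \<in> stab (pt x n)" by blast
    then have "k \<in> stab (pt x (max N m))" by simp
    then show "k \<in> lim_stab x" using *[of "max N m"] by simp
  qed (use * in blast)
qed

lemma lim_stab_subgroup:
  assumes "x \<in> X0" shows "subgroup (lim_stab x) G"
proof -
  have st: "subgroup (stab (pt x n)) G" for n
    by (rule stab_subgroup[OF GH0_pt(1)[OF assms]])
  show ?thesis
  proof (rule subgroupI)
    show "lim_stab x \<subseteq> carrier G" by (rule lim_stab_carrier)
    have "\<one> \<in> lim_stab x" using lim_stab_eventually[OF assms] subgroup.one_closed[OF st] by simp
    then show "lim_stab x \<noteq> {}" by blast
  next
    fix a assume a: "a \<in> lim_stab x"
    then have "a \<in> carrier G" using lim_stab_carrier by blast
    then show "inv a \<in> lim_stab x"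
      using lim_stab_eventually[OF assms] subgroup.m_inv_closed[OF st] a by (metis inv_closed)
  next
    fix a b assume ab: "a \<in> lim_stab x" "b \<in> lim_stab x"
    then have c: "a \<in> carrier G" "b \<in> carrier G" using lim_stab_carrier by blast+
    obtain M where M: "\<forall>n\<ge>M. a \<in> stab (pt x n)"
      using lim_stab_eventually[OF assms c(1)] ab(1) by auto
    obtain N where N: "\<forall>n\<ge>N. b \<in> stab (pt x n)"
      using lim_stab_eventually[OF assms c(2)] ab(2) by auto
    from M N have "\<forall>n\<ge>max M N. a \<otimes> b \<in> stab (pt x n)" using subgroup.m_closed[OF st] by simp
    then show "a \<otimes> b \<in> lim_stab x" using lim_stab_eventually[OF assms] c by blast
  qed
qed

lemma GH0_class_iff:
  assumes "x \<in> X0" "p \<in> V"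
  shows "x n = ball_class G Q H n p \<longleftrightarrow> agree n (lim_stab x) (stab p)"
  using GH0_pt[OF assms(1)] lim_stab_agree[OF assms(1)] assms(2)
  by (metis ball_class_eq_iff agree_sym agree_trans)

lemma GH0_coord_iff:
  assumes "x \<in> X0" "y \<in> X0"
  shows "x n = y n \<longleftrightarrow> agree n (lim_stab x) (lim_stab y)"
  using GH0_class_iff[OF assms(1) GH0_pt(1)[OF assms(2)]] GH0_pt(2)[OF assms(2)]
    lim_stab_agree[OF assms(2)] agree_sym agree_trans by metis

lemma GH0_coord_mono:
  "x \<in> X0 \<Longrightarrow> y \<in> X0 \<Longrightarrow> x n = y n \<Longrightarrow> m \<le> n \<Longrightarrow> x m = y m"
  using GH0_coord_iff agree_mono by blast

lemma GH0_ext: "x \<in> X0 \<Longrightarrow> y \<in> X0 \<Longrightarrow> lim_stab x = lim_stab y \<Longrightarrow> x = y"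
  by (rule ext) (simp add: GH0_coord_iff)

text \<open>The unit given by an actual vertex; it corresponds to the subgroup
  \<open>stab p\<close>. Means on the groupoid are later pulled back to the graph along this
  map.\<close>

definition vx :: "'a set \<Rightarrow> nat \<Rightarrow> 'a set set" where
  "vx p = (\<lambda>n. ball_class G Q H n p)"

lemma vx_GH0: "p \<in> V \<Longrightarrow> vx p \<in> X0"
  unfolding vx_def GH0_def by blast

lemma lim_stab_vx:
  assumes "p \<in> V" shows "lim_stab (vx p) = stab p"
proof (rule agree_all)
  show "stab p \<subseteq> carrier G" by (auto simp: stab_def)
  show "agree n (lim_stab (vx p)) (stab p)" for n
    using GH0_class_iff[OF vx_GH0[OF assms] assms] by (simp add: vx_def)
qed (rule lim_stab_carrier)

section \<open>Arrows as cosets, and the groupoid operations on them\<close>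

lemma snd_arr:
  assumes "x \<in> X0" "g \<in> carrier G"
  shows "snd (arr x g) = {h \<in> carrier G. inv g \<otimes> h \<in> lim_stab x}"
  using assms by (simp add: GH_arr_def lim_stab_eventually act_eq_iff GH0_pt(1) cong: conj_cong)

lemma fst_arr [simp]: "fst (arr x g) = x"
  by (simp add: GH_arr_def)

lemma arr_eq_iff:
  assumes "x \<in> X0" "g \<in> carrier G" "h \<in> carrier G"
  shows "arr x g = arr x h \<longleftrightarrow> inv g \<otimes> h \<in> lim_stab x"
proof -
  interpret K: subgroup "lim_stab x" G by (rule lim_stab_subgroup[OF assms(1)])
  show ?thesis
  proof
    assume "arr x g = arr x h"
    moreover have "h \<in> snd (arr x h)" using assms by (simp add: snd_arr)
    ultimately have "h \<in> snd (arr x g)" by simp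
    then show "inv g \<otimes> h \<in> lim_stab x" using assms by (simp add: snd_arr)
  next
    assume gh: "inv g \<otimes> h \<in> lim_stab x"
    then have hg: "inv h \<otimes> g \<in> lim_stab x" using K.m_inv_closed[OF gh] assms by (simp add: inv_mult_group)
    have "inv g \<otimes> k \<in> lim_stab x \<longleftrightarrow> inv h \<otimes> k \<in> lim_stab x" if "k \<in> carrier G" for k
    proof
      assume "inv g \<otimes> k \<in> lim_stab x"
      from K.m_closed[OF hg this] show "inv h \<otimes> k \<in> lim_stab x"
        using assms that by (simp add: m_assoc) (simp add: m_assoc[symmetric])
    next
      assume "inv h \<otimes> k \<in> lim_stab x"
      from K.m_closed[OF gh this] show "inv g \<otimes> k \<in> lim_stab x"
        using assms that by (simp add: m_assoc) (simp add: m_assoc[symmetric])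
    qed
    then have "snd (arr x g) = snd (arr x h)" using assms by (auto simp: snd_arr)
    then show "arr x g = arr x h" by (simp add: prod_eq_iff)
  qed
qed

text \<open>Near its unit a range fibre looks like the Schreier graph: if \<open>x\<close> and
  \<open>p\<close> agree to level \<open>n\<close>, short words have the same coincidences as arrows
  over \<open>x\<close> and as vertices seen from \<open>p\<close>.\<close>

lemma arr_eq_agree:
  assumes "x \<in> X0" "p \<in> V" "agree n (lim_stab x) (stab p)" "g \<in> wball k" "h \<in> wball l" "k + l \<le> 2 * n + 1"
  shows "arr x g = arr x h \<longleftrightarrow> g <# p = h <# p"
  using assms agreeD[OF assms(3) wball_mult[OF wball_inv[OF assms(4)] assms(5)]]
  by (simp add: act_eq_iff arr_eq_iff wball_carrier)

lemma arr_GH: "x \<in> X0 \<Longrightarrow> g \<in> carrier G \<Longrightarrow> arr x g \<in> GH G Q H"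
  by (auto simp: GH_def)

lemma rep_arr:
  assumes "x \<in> X0" "g \<in> carrier G"
  shows "GH_rep (arr x g) \<in> carrier G" "inv g \<otimes> GH_rep (arr x g) \<in> lim_stab x"
proof -
  interpret K: subgroup "lim_stab x" G by (rule lim_stab_subgroup[OF assms(1)])
  have "g \<in> snd (arr x g)" using assms by (simp add: snd_arr)
  then have "GH_rep (arr x g) \<in> snd (arr x g)" unfolding GH_rep_def by (rule someI)
  then show "GH_rep (arr x g) \<in> carrier G" "inv g \<otimes> GH_rep (arr x g) \<in> lim_stab x"
    using assms by (auto simp: snd_arr)
qed

text \<open>Conjugating by \<open>g\<close> lengthens an element by at most \<open>2l\<close>, which
  costs \<open>l\<close> levels since level \<open>n\<close> sees length \<open>2n + 1\<close>. This
  explains the shift by \<open>wlen G Q g\<close> in \<open>GH_act\<close>.\<close>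

lemma agree_conj:
  assumes "p \<in> V" "p' \<in> V" "g \<in> wball l" "agree (n + l) (stab p) (stab p')"
  shows "agree n (stab (g <# p)) (stab (g <# p'))"
  unfolding agree_iff
proof
  fix h assume h: "h \<in> wball (2 * n + 1)"
  have "inv g \<otimes> h \<otimes> g \<in> wball (l + (2 * n + 1) + l)"
    using h assms(3) by (intro wball_mult wball_inv)
  then have "inv g \<otimes> h \<otimes> g \<in> stab p \<longleftrightarrow> inv g \<otimes> h \<otimes> g \<in> stab p'"
    using agreeD[OF assms(4)] by simp
  then show "h \<in> stab (g <# p) \<longleftrightarrow> h \<in> stab (g <# p')"
    using assms by (simp add: stab_act wball_carrier)
qed

lemma GH_act_GH0:
  assumes "x \<in> X0" "g \<in> carrier G"
  shows "GH_act G Q H g x \<in> X0"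
  unfolding GH0_def GH_act_def mem_Collect_eq
proof
  fix n
  let ?p = "\<lambda>n. pt x (n + wlen G Q g)"
  have V: "?p m \<in> V" for m by (rule GH0_pt[OF assms(1)])
  have "agree n (stab (g <# ?p n)) (stab (g <# ?p (Suc n)))"
    using GH0_agree[OF assms(1), of "n + wlen G Q g" "Suc n + wlen G Q g"]
    by (intro agree_conj[OF V V wball_ex[OF assms(2)]]) (auto intro: agree_sym)
  then show "\<exists>p\<in>V. ball_class G Q H (Suc n) (g <# ?p (Suc n)) = ball_class G Q H (Suc n) p \<and>
      ball_class G Q H n (g <# ?p n) = ball_class G Q H n p"
    using V assms(2) act_V by (intro bexI[of _ "g <# ?p (Suc n)"] conjI refl) (simp_all add: ball_class_eq_iff del: add_Suc)
qed

lemma lim_stab_act: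
  assumes "x \<in> X0" "g \<in> carrier G"
  shows "h \<in> lim_stab (GH_act G Q H g x) \<longleftrightarrow> h \<in> carrier G \<and> inv g \<otimes> h \<otimes> g \<in> lim_stab x"
proof (cases "h \<in> carrier G")
  case True
  obtain n where n: "h \<in> wball (2 * n + 1)" using carrier_wball True by blast
  define p where "p = pt x (n + wlen G Q g)"
  have p: "p \<in> V" unfolding p_def by (rule GH0_pt[OF assms(1)])
  have "inv g \<otimes> h \<otimes> g \<in> wball (wlen G Q g + (2 * n + 1) + wlen G Q g)"
    using n wball_ex[OF assms(2)] by (intro wball_mult wball_inv)
  then have 1: "inv g \<otimes> h \<otimes> g \<in> lim_stab x \<longleftrightarrow> inv g \<otimes> h \<otimes> g \<in> stab p"
    using agreeD[OF lim_stab_agree[OF assms(1), of "n + wlen G Q g"]] by (simp add: p_def)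
  have "agree n (lim_stab (GH_act G Q H g x)) (stab (g <# p))"
    using GH0_class_iff[OF GH_act_GH0[OF assms] act_V[OF assms(2) p], of n]
    by (simp add: GH_act_def p_def)
  then have "h \<in> lim_stab (GH_act G Q H g x) \<longleftrightarrow> h \<in> stab (g <# p)"
    using n by (simp add: agree_iff)
  then show ?thesis using 1 True assms p by (simp add: stab_act)
qed (use lim_stab_carrier in blast)

lemma act_vx: "p \<in> V \<Longrightarrow> g \<in> carrier G \<Longrightarrow> GH_act G Q H g (vx p) = vx (g <# p)"
  by (rule GH0_ext) (auto simp: vx_GH0 GH_act_GH0 act_V lim_stab_act lim_stab_vx stab_act)

text \<open>Elements of a subgroup conjugate it to itself, so the source of an arrow does not depend
  on the representative chosen by \<open>GH_rep\<close>.\<close>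

lemma act_coset:
  assumes "x \<in> X0" "g \<in> carrier G" "h \<in> carrier G" "inv g \<otimes> h \<in> lim_stab x"
  shows "GH_act G Q H h x = GH_act G Q H g x"
proof (rule GH0_ext)
  interpret K: subgroup "lim_stab x" G by (rule lim_stab_subgroup[OF assms(1)])
  define k where "k = inv g \<otimes> h"
  have k: "k \<in> lim_stab x" "k \<in> carrier G" "inv k \<in> lim_stab x" using assms by (auto simp: k_def)
  have h: "h = g \<otimes> k" using assms by (simp add: k_def m_assoc[symmetric])
  have "inv h \<otimes> u \<otimes> h \<in> lim_stab x \<longleftrightarrow> inv g \<otimes> u \<otimes> g \<in> lim_stab x" if u: "u \<in> carrier G" for u
  proof -
    have *: "inv h \<otimes> u \<otimes> h = inv k \<otimes> (inv g \<otimes> u \<otimes> g) \<otimes> k"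
      using assms k u by (simp add: h inv_mult_group m_assoc)
    have **: "inv g \<otimes> u \<otimes> g = k \<otimes> (inv h \<otimes> u \<otimes> h) \<otimes> inv k"
      using assms k u unfolding * by (simp add: m_assoc mult_inv_cancel)
    show ?thesis using * ** k K.m_closed by metis
  qed
  then show "lim_stab (GH_act G Q H h x) = lim_stab (GH_act G Q H g x)"
    using assms by (auto simp: lim_stab_act)
qed (use assms in \<open>auto simp: GH_act_GH0\<close>)

lemma GH_s_arr: "x \<in> X0 \<Longrightarrow> g \<in> carrier G \<Longrightarrow> GH_s G Q H (arr x g) = GH_act G Q H g x"
  unfolding GH_s_def fst_arr by (rule act_coset) (auto simp: rep_arr)

lemma GH_r_arr [simp]: "GH_r (arr x g) = x"
  by (simp add: GH_r_def)

text \<open>Absorbs the three choices of representatives made by \<open>GH_rep\<close>. In coset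
  terms, translation by the inverse arrow is right multiplication by \<open>inv g\<close>.\<close>

lemma mult_inv_arr:
  assumes "x \<in> X0" "g \<in> carrier G" "h \<in> carrier G"
  shows "GH_mult G (GH_inv G Q H (arr x g)) (arr x h) = arr (GH_act G Q H g x) (h \<otimes> inv g)"
proof -
  let ?y = "GH_act G Q H g x"
  interpret K: subgroup "lim_stab x" G by (rule lim_stab_subgroup[OF assms(1)])
  have y: "?y \<in> X0" using assms by (simp add: GH_act_GH0)
  interpret L: subgroup "lim_stab ?y" G by (rule lim_stab_subgroup[OF y])
  define a where "a = GH_rep (arr x g)"
  have a: "a \<in> carrier G" "inv g \<otimes> a \<in> lim_stab x" using rep_arr assms by (auto simp: a_def)
  define b where "b = GH_rep (arr ?y (inv a))"
  have b: "b \<in> carrier G" "a \<otimes> b \<in> lim_stab ?y"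
    using rep_arr[OF y, of "inv a"] a by (auto simp: b_def)
  define c where "c = GH_rep (arr x h)"
  have c: "c \<in> carrier G" "inv h \<otimes> c \<in> lim_stab x" using rep_arr assms by (auto simp: c_def)
  have "GH_mult G (GH_inv G Q H (arr x g)) (arr x h) = arr ?y (c \<otimes> b)"
    using assms by (simp add: GH_mult_def GH_inv_def GH_s_arr a_def b_def c_def)
  also have "\<dots> = arr ?y (h \<otimes> inv g)"
  proof -
    \<comment> \<open>Conjugated by \<open>g\<close>, the discrepancy caused by \<open>c\<close> and
      \<open>a\<close> is a product of elements of \<open>lim_stab x\<close>; the choice of
      \<open>b\<close> contributes the remaining factor \<open>a \<otimes> b\<close>.\<close>
    have "inv g \<otimes> (g \<otimes> inv h \<otimes> c \<otimes> inv a) \<otimes> g = (inv h \<otimes> c) \<otimes> inv (inv g \<otimes> a)"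
      using assms a b c by (simp add: m_assoc inv_mult_group mult_inv_cancel)
    then have "g \<otimes> inv h \<otimes> c \<otimes> inv a \<in> lim_stab ?y"
      using assms a c by (simp add: lim_stab_act)
    from L.m_closed[OF this b(2)] have "inv (h \<otimes> inv g) \<otimes> (c \<otimes> b) \<in> lim_stab ?y"
      using assms a b c by (simp add: m_assoc inv_mult_group mult_inv_cancel)
    then show ?thesis using arr_eq_iff[OF y, of "h \<otimes> inv g" "c \<otimes> b"] assms b c by simp
  qed
  finally show ?thesis .
qed


subsection \<open>The topologies on units and arrows\<close>

abbreviation XT where "XT \<equiv> GH0_top G Q H"
abbreviation GT where "GT \<equiv> GH_top G Q H"

lemma coord_Eclasses: "x \<in> X0 \<Longrightarrow> x n \<in> Eclasses G Q H n"
  unfolding Eclasses_def using GH0_pt by blast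

lemma topspace_XT [simp]: "topspace XT = X0"
  unfolding GH0_top_def using coord_Eclasses by auto

lemma openin_coordinate:
  "openin (product_topology (\<lambda>n. discrete_topology (E n)) UNIV) {y \<in> PiE UNIV E. y M = c}"
proof -
  have "{y \<in> PiE UNIV E. y M = c} =
      {y \<in> topspace (product_topology (\<lambda>n. discrete_topology (E n)) UNIV). y M \<in> {c} \<inter> E M}"
    by auto
  also have "openin (product_topology (\<lambda>n. discrete_topology (E n)) UNIV) \<dots>"
    by (rule openin_continuous_map_preimage[OF continuous_map_product_projection]) auto
  finally show ?thesis .
qed

lemma openin_cylinder: "openin XT {y \<in> X0. y M = c}"
proof -
  have "{y \<in> X0. y M = c} = {y \<in> PiE UNIV (Eclasses G Q H). y M = c} \<inter> X0"
    using coord_Eclasses by auto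
  then show ?thesis
    unfolding GH0_top_def openin_subtopology
    by (intro exI[of _ "{y \<in> PiE UNIV (Eclasses G Q H). y M = c}"] conjI openin_coordinate)
qed

text \<open>Coordinates are nested, so the finitely many constraints of a basic product
  neighbourhood follow from a single coordinate that is large enough.\<close>

lemma openin_XT_iff:
  "openin XT U \<longleftrightarrow> U \<subseteq> X0 \<and> (\<forall>x\<in>U. \<exists>M. \<forall>y\<in>X0. y M = x M \<longrightarrow> y \<in> U)"
proof (intro iffI conjI ballI)
  assume U: "openin XT U"
  show UX: "U \<subseteq> X0" using openin_subset[OF U] by simp
  fix x assume x: "x \<in> U"
  obtain T where T: "openin (product_topology (\<lambda>n. discrete_topology (Eclasses G Q H n)) UNIV) T"
    "U = T \<inter> X0" using U unfolding GH0_top_def openin_subtopology by blast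
  then obtain B where B: "finite {i. B i \<noteq> Eclasses G Q H i}" "x \<in> PiE UNIV B" "PiE UNIV B \<subseteq> T"
    using x unfolding openin_product_topology_alt by fastforce
  obtain M where M: "\<forall>i\<in>{i. B i \<noteq> Eclasses G Q H i}. i \<le> M"
    using B(1) finite_nat_set_iff_bounded_le by blast
  have "y \<in> U" if y: "y \<in> X0" "y M = x M" for y
  proof -
    have "y i \<in> B i" for i
    proof (cases "B i = Eclasses G Q H i")
      case False
      then have "y i = x i" using M y GH0_coord_mono x UX by blast
      then show ?thesis using B(2) by auto
    qed (use y coord_Eclasses in auto)
    then show ?thesis using B T y by auto
  qed
  then show "\<exists>M. \<forall>y\<in>X0. y M = x M \<longrightarrow> y \<in> U" by blast
next
  assume *: "U \<subseteq> X0 \<and> (\<forall>x\<in>U. \<exists>M. \<forall>y\<in>X0. y M = x M \<longrightarrow> y \<in> U)"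
  show "openin XT U"
  proof (subst openin_subopen, intro ballI)
    fix x assume "x \<in> U"
    then obtain M where "\<forall>y\<in>X0. y M = x M \<longrightarrow> y \<in> U" "x \<in> X0" using * by blast
    then show "\<exists>T. openin XT T \<and> x \<in> T \<and> T \<subseteq> U"
      by (intro exI[of _ "{y \<in> X0. y M = x M}"]) (auto intro: openin_cylinder)
  qed
qed

text \<open>Not lying in the inverse limit is visible on two consecutive coordinates, so the limit
  is closed in a product of finite discrete spaces, which is compact by Tychonoff.\<close>

lemma compact_XT: "compactin XT X0"
proof -
  let ?P = "product_topology (\<lambda>n. discrete_topology (Eclasses G Q H n)) (UNIV :: nat set)"
  have P: "compact_space ?P"
    by (simp add: compact_space_product_topology compact_space_discrete_topology finite_Eclasses)
  have sub: "X0 \<subseteq> topspace ?P" using coord_Eclasses by auto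
  have "openin ?P (topspace ?P - X0)"
  proof (subst openin_subopen, intro ballI)
    fix x assume x: "x \<in> topspace ?P - X0"
    then obtain n where n: "\<not> (\<exists>p\<in>V. x (Suc n) = ball_class G Q H (Suc n) p \<and> x n = ball_class G Q H n p)"
      unfolding GH0_def by blast
    let ?T = "{y \<in> PiE UNIV (Eclasses G Q H). y n = x n} \<inter> {y \<in> PiE UNIV (Eclasses G Q H). y (Suc n) = x (Suc n)}"
    have "openin ?P ?T" by (intro openin_Int openin_coordinate)
    moreover have "?T \<subseteq> topspace ?P - X0" using n unfolding GH0_def by fastforce
    ultimately show "\<exists>T. openin ?P T \<and> x \<in> T \<and> T \<subseteq> topspace ?P - X0"
      using x by (intro exI[of _ ?T]) auto
  qed
  then have "closedin ?P X0" using sub by (simp add: closedin_def)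
  then have "compactin ?P X0" using P closedin_compact_space by blast
  then show ?thesis unfolding GH0_top_def by (simp add: compactin_subtopology)
qed

text \<open>Compactness in the form used below: a property that holds near each point at some level,
  and persists at higher levels, holds everywhere at one level, the maximum over a finite subcover
  by cylinders.\<close>

lemma uniformly_on_GH0:
  assumes loc: "\<And>x. x \<in> X0 \<Longrightarrow> \<exists>M. \<forall>y\<in>X0. y M = x M \<longrightarrow> \<Phi> M y"
    and mono: "\<And>M N y. y \<in> X0 \<Longrightarrow> \<Phi> M y \<Longrightarrow> M \<le> N \<Longrightarrow> \<Phi> N y"
  shows "\<exists>N. \<forall>y\<in>X0. \<Phi> N y"
proof -
  obtain M where M: "\<And>x y. x \<in> X0 \<Longrightarrow> y \<in> X0 \<Longrightarrow> y (M x) = x (M x) \<Longrightarrow> \<Phi> (M x) y"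
    using loc by metis
  let ?C = "(\<lambda>x. {y \<in> X0. y (M x) = x (M x)}) ` X0"
  have "\<forall>C\<in>?C. openin XT C" using openin_cylinder by blast
  moreover have "X0 \<subseteq> \<Union>?C" by blast
  ultimately obtain F where F: "finite F" "F \<subseteq> ?C" "X0 \<subseteq> \<Union>F"
    using compact_XT unfolding compactin_def by meson
  then obtain Y where Y: "finite Y" "Y \<subseteq> X0" "F = (\<lambda>x. {y \<in> X0. y (M x) = x (M x)}) ` Y"
    using finite_subset_image[OF F(1,2)] by blast
  obtain N where N: "\<And>x. x \<in> Y \<Longrightarrow> M x \<le> N"
    using finite_nat_set_iff_bounded_le[of "M ` Y"] Y(1) by auto
  have "\<Phi> N y" if y: "y \<in> X0" for y
  proof -
    obtain x where "x \<in> Y" "y (M x) = x (M x)" using F(3) Y(3) y by blast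
    then show ?thesis using M N mono Y(2) y by blast
  qed
  then show ?thesis by blast
qed

section \<open>The topology of the arrow space\<close>

lemma arr_fst: "arr x g = arr y h \<Longrightarrow> x = y"
  by (metis fst_arr)

lemma GH_eq: "GH G Q H = {arr x g | x g. x \<in> X0 \<and> g \<in> carrier G}"
  by (simp add: GH_def)

lemma openin_basic:
  assumes "g \<in> carrier G" "wlen G Q g \<le> N"
  shows "openin GT {arr x g | x. x \<in> X0 \<and> x N = c}"
proof (cases "c \<in> Eclasses G Q H N")
  case True
  show ?thesis unfolding GH_top_def
    by (rule topology_generated_by_Basis) (use assms True in blast)
next
  case False
  then have "{arr x g | x. x \<in> X0 \<and> x N = c} = {}" using coord_Eclasses by auto
  then show ?thesis by (simp only: openin_empty)
qed

text \<open>Meets every range fibre in exactly one arrow; for \<open>g\<close> in the group these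
  sets are compact and open, and they cover the arrow space.\<close>

definition bisec :: "'a \<Rightarrow> ((nat \<Rightarrow> 'a set set) \<times> 'a set) set" where
  "bisec g = (\<lambda>x. arr x g) ` X0"

lemma openin_bisec:
  assumes "g \<in> carrier G" shows "openin GT (bisec g)"
proof -
  have "bisec g = (\<Union>c. {arr x g | x. x \<in> X0 \<and> x (wlen G Q g) = c})" by (auto simp: bisec_def)
  then show ?thesis using openin_basic[OF assms] by auto
qed

lemma topspace_GT [simp]: "topspace GT = GH G Q H"
proof
  show "topspace GT \<subseteq> GH G Q H"
    unfolding GH_top_def topology_generated_by_topspace GH_eq by blast
  show "GH G Q H \<subseteq> topspace GT"
    using openin_subset[OF openin_bisec] unfolding GH_eq bisec_def by blast
qed

lemma lim_stab_local:
  assumes "k \<in> carrier G"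
  shows "\<exists>M. \<forall>x\<in>X0. \<forall>y\<in>X0. x M = y M \<longrightarrow> (k \<in> lim_stab x \<longleftrightarrow> k \<in> lim_stab y)"
proof -
  obtain M where "k \<in> wball (2 * M + 1)" using carrier_wball assms by blast
  then show ?thesis by (metis GH0_coord_iff agree_iff)
qed

text \<open>The preimage of a basic open set is cut out by one coordinate and by whether
  \<open>inv g \<otimes> h\<close> lies in \<open>lim_stab x\<close>, a locally constant
  condition.\<close>

lemma continuous_arr:
  assumes g: "g \<in> carrier G"
  shows "continuous_map XT GT (\<lambda>x. arr x g)"
  unfolding GH_top_def
proof (rule continuous_on_generated_topo)
  show "(\<lambda>x. arr x g) ` topspace XT \<subseteq> \<Union> {{arr x g |x. x \<in> X0 \<and> x N = c} |N c g.
          c \<in> Eclasses G Q H N \<and> g \<in> carrier G \<and> wlen G Q g \<le> N}"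
    using arr_GH[OF _ g] topspace_GT unfolding GH_top_def topology_generated_by_topspace by auto
next
  fix U assume "U \<in> {{arr x g |x. x \<in> X0 \<and> x N = c} |N c g.
          c \<in> Eclasses G Q H N \<and> g \<in> carrier G \<and> wlen G Q g \<le> N}"
  then obtain N c h where U: "U = {arr x h |x. x \<in> X0 \<and> x N = c}" "h \<in> carrier G" by blast
  obtain M where M: "\<And>x y. x \<in> X0 \<Longrightarrow> y \<in> X0 \<Longrightarrow> x M = y M \<Longrightarrow> inv g \<otimes> h \<in> lim_stab x \<longleftrightarrow> inv g \<otimes> h \<in> lim_stab y"
    using lim_stab_local[of "inv g \<otimes> h"] g U(2) by auto
  have eq: "(\<lambda>x. arr x g) -` U \<inter> topspace XT = {x \<in> X0. x N = c \<and> inv g \<otimes> h \<in> lim_stab x}"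
  proof -
    have "arr x g \<in> U \<longleftrightarrow> x N = c \<and> inv g \<otimes> h \<in> lim_stab x" if "x \<in> X0" for x
    proof -
      have "arr x g \<in> U \<longleftrightarrow> x N = c \<and> arr x g = arr x h"
        unfolding U(1) using that by (auto dest: arr_fst)
      then show ?thesis using that g U(2) by (simp add: arr_eq_iff)
    qed
    then show ?thesis unfolding topspace_XT by blast
  qed
  show "openin XT ((\<lambda>x. arr x g) -` U \<inter> topspace XT)"
    unfolding eq openin_XT_iff
  proof (intro conjI ballI)
    fix x assume x: "x \<in> {x \<in> X0. x N = c \<and> inv g \<otimes> h \<in> lim_stab x}"
    have "y \<in> {x \<in> X0. x N = c \<and> inv g \<otimes> h \<in> lim_stab x}" if "y \<in> X0" "y (max M N) = x (max M N)" for y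
      using GH0_coord_mono[of y x "max M N"] x that M[of x y] by auto
    then show "\<exists>M. \<forall>y\<in>X0. y M = x M \<longrightarrow> y \<in> {x \<in> X0. x N = c \<and> inv g \<otimes> h \<in> lim_stab x}" by blast
  qed auto
qed

lemma closedin_bisec:
  assumes g: "g \<in> carrier G" shows "closedin GT (bisec g)"
  unfolding closedin_def
proof
  show "bisec g \<subseteq> topspace GT" using arr_GH g by (auto simp: bisec_def)
  show "openin GT (topspace GT - bisec g)"
  proof (subst openin_subopen, intro ballI)
    fix a assume a: "a \<in> topspace GT - bisec g"
    then obtain x h where x: "a = arr x h" "x \<in> X0" "h \<in> carrier G" by (auto simp: GH_eq)
    have n: "inv h \<otimes> g \<notin> lim_stab x" using a x g arr_eq_iff[OF x(2,3) g] by (auto simp: bisec_def)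
    obtain M where M: "\<And>y. y \<in> X0 \<Longrightarrow> y M = x M \<Longrightarrow> inv h \<otimes> g \<in> lim_stab y \<longleftrightarrow> inv h \<otimes> g \<in> lim_stab x"
      using lim_stab_local[of "inv h \<otimes> g"] g x by auto
    \<comment> \<open>Basic open sets around \<open>arr x h\<close> are available only at levels not
      below the word length of \<open>h\<close>.\<close>
    let ?N = "max M (wlen G Q h)"
    let ?T = "{arr y h | y. y \<in> X0 \<and> y ?N = x ?N}"
    have "openin GT ?T" using x by (intro openin_basic) auto
    moreover have "arr y h \<notin> bisec g" if y: "y \<in> X0" "y ?N = x ?N" for y
    proof
      assume "arr y h \<in> bisec g"
      then have "arr y h = arr y g" by (auto simp: bisec_def dest: arr_fst)
      then have "inv h \<otimes> g \<in> lim_stab y" using arr_eq_iff y x g by blast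
      moreover have "y M = x M" by (rule GH0_coord_mono[OF y(1) x(2) y(2)]) simp
      ultimately show False using n M y by blast
    qed
    ultimately show "\<exists>T. openin GT T \<and> a \<in> T \<and> T \<subseteq> topspace GT - bisec g"
      using x arr_GH by (intro exI[of _ ?T]) auto
  qed
qed

lemma compactin_bisec: "g \<in> carrier G \<Longrightarrow> compactin GT (bisec g)"
  unfolding bisec_def by (rule image_compactin[OF compact_XT continuous_arr])

text \<open>These compact open sets exhaust the arrow space, so they can stand for arbitrary compact
  sets in the definition of amenability.\<close>

definition tube :: "nat \<Rightarrow> ((nat \<Rightarrow> 'a set set) \<times> 'a set) set" where
  "tube n = (\<Union>g\<in>wball n. bisec g)"

lemma tube_eq: "tube n = {arr x g | x g. x \<in> X0 \<and> g \<in> wball n}"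
  by (auto simp: tube_def bisec_def)

lemma compactin_tube: "compactin GT (tube n)"
  unfolding tube_def using compactin_bisec finite_wball wball_carrier
  by (intro compactin_Union) auto

lemma compactin_subset_tube:
  assumes "compactin GT K" shows "\<exists>n. K \<subseteq> tube n"
proof -
  have "\<forall>U\<in>range tube. openin GT U"
    unfolding tube_def using openin_bisec wball_carrier by auto
  moreover have "K \<subseteq> \<Union>(range tube)"
  proof
    fix a assume "a \<in> K"
    then have "a \<in> GH G Q H" using compactin_subset_topspace[OF assms] by auto
    then obtain x g where "a = arr x g" "x \<in> X0" "g \<in> carrier G" by (auto simp: GH_eq)
    then have "a \<in> tube (wlen G Q g)" using wball_ex unfolding tube_eq by blast
    then show "a \<in> \<Union>(range tube)" by blast
  qed
  ultimately obtain F where F: "finite F" "F \<subseteq> range tube" "K \<subseteq> \<Union>F"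
    using assms unfolding compactin_def by meson
  then obtain I where I: "finite I" "F = tube ` I"
    using finite_subset_image[OF F(1,2)] by blast
  obtain N where N: "\<And>i. i \<in> I \<Longrightarrow> i \<le> N"
    using I(1) finite_nat_set_iff_bounded_le by auto
  have "tube i \<subseteq> tube N" if "i \<in> I" for i
    using wball_mono N[OF that] by (auto simp: tube_def)
  then have "\<Union>F \<subseteq> tube N" unfolding I(2) by blast
  with F(3) show ?thesis by blast
qed

section \<open>Sums over range fibres\<close>

abbreviation fibre where "fibre x \<equiv> {h \<in> topspace GT. GH_r h = x}"

lemma fibre_eq: "x \<in> X0 \<Longrightarrow> fibre x = arr x ` carrier G"
  using arr_GH by (auto simp: GH_eq)

abbreviation gball :: "nat \<Rightarrow> 'a set \<Rightarrow> 'a set set" where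
  "gball n p \<equiv> (\<lambda>g. g <# p) ` wball n"

text \<open>By \<open>arr_eq_agree\<close>, \<open>g <# p \<mapsto> arr x g\<close> is a well
  defined bijection from the ball of vertices onto the arrows over \<open>x\<close> of length at
  most \<open>n\<close>.\<close>

lemma sum_arr_gball:
  assumes "x \<in> X0" "p \<in> V" "agree n (lim_stab x) (stab p)"
    and F: "\<And>g. g \<in> wball n \<Longrightarrow> F (arr x g) = f (g <# p)"
  shows "sum F (arr x ` wball n) = sum f (gball n p)"
proof -
  define \<phi> where "\<phi> v = arr x (SOME g. g \<in> wball n \<and> g <# p = v)" for v
  have eq: "arr x g = arr x h \<longleftrightarrow> g <# p = h <# p" if "g \<in> wball n" "h \<in> wball n" for g h
    using arr_eq_agree[OF assms(1-3) that] by simp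
  have \<phi>: "\<phi> (g <# p) = arr x g" if g: "g \<in> wball n" for g
  proof -
    have "\<exists>h. h \<in> wball n \<and> h <# p = g <# p" using g by blast
    from someI_ex[OF this] show ?thesis unfolding \<phi>_def using eq g by blast
  qed
  have "inj_on \<phi> (gball n p)" by (auto simp: inj_on_def \<phi> eq)
  moreover have "\<phi> ` gball n p = arr x ` wball n" by (auto simp: \<phi> image_image)
  ultimately have "sum F (arr x ` wball n) = (\<Sum>v\<in>gball n p. F (\<phi> v))"
    by (metis (no_types, lifting) sum.reindex_cong)
  also have "\<dots> = sum f (gball n p)" by (rule sum.cong) (auto simp: \<phi> F)
  finally show ?thesis .
qed

lemma has_sum_fibre:
  fixes F :: "(nat \<Rightarrow> 'a set set) \<times> 'a set \<Rightarrow> real"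
  assumes "x \<in> X0" "p \<in> V" "agree n (lim_stab x) (stab p)"
    and F: "\<And>g. g \<in> wball n \<Longrightarrow> F (arr x g) = f (g <# p)"
    and F0: "\<And>g. g \<in> carrier G \<Longrightarrow> arr x g \<notin> arr x ` wball n \<Longrightarrow> F (arr x g) = 0"
  shows "(F has_sum sum f (gball n p)) (fibre x)"
proof -
  have "(F has_sum sum F (arr x ` wball n)) (arr x ` wball n)"
    using finite_wball by (intro has_sum_finite) simp
  then have "(F has_sum sum F (arr x ` wball n)) (fibre x)"
    using wball_carrier F0 unfolding fibre_eq[OF assms(1)]
    by (subst (asm) has_sum_cong_neutral[where T = "arr x ` carrier G" and g = F]) auto
  then show ?thesis using sum_arr_gball[OF assms(1-3), of F f] F by simp
qed

end

section \<open>Finitely supported vectors and Cauchy--Schwarz\<close>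

lemma l2norm_finite:
  assumes "finite F" "\<And>v. v \<notin> F \<Longrightarrow> f v = 0"
  shows "l2norm f = L2_set f F"
proof -
  have "(\<Sum>\<^sub>\<infinity>v. (f v)\<^sup>2) = (\<Sum>\<^sub>\<infinity>v\<in>F. (f v)\<^sup>2)"
    by (rule infsum_cong_neutral) (use assms in auto)
  then show ?thesis using assms by (simp add: l2norm_def L2_set_def)
qed

text \<open>Factor the difference of squares and apply Cauchy--Schwarz; this passes from the
  l2-variation of vectors to the l1-variation of their squares.\<close>

lemma sum_abs_diff_squares_le:
  assumes "finite F"
  shows "(\<Sum>v\<in>F. \<bar>(f v)\<^sup>2 - (g v)\<^sup>2\<bar>) \<le> L2_set (\<lambda>v. f v - g v) F * (L2_set f F + L2_set g F)"
proof -
  have "(\<Sum>v\<in>F. \<bar>(f v)\<^sup>2 - (g v)\<^sup>2\<bar>) = (\<Sum>v\<in>F. \<bar>f v - g v\<bar> * \<bar>f v + g v\<bar>)"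
    by (simp add: abs_mult[symmetric] power2_eq_square algebra_simps)
  also have "\<dots> \<le> L2_set (\<lambda>v. f v - g v) F * L2_set (\<lambda>v. f v + g v) F"
    by (rule L2_set_mult_ineq)
  also have "\<dots> \<le> L2_set (\<lambda>v. f v - g v) F * (L2_set f F + L2_set g F)"
    by (intro mult_left_mono L2_set_triangle_ineq) simp
  finally show ?thesis .
qed

context schreier begin

text \<open>The chosen element does not depend on a unit, so
  \<open>x \<mapsto> arr x (sect n p v)\<close> stays in one continuous bisection as
  \<open>x\<close> varies.\<close>

definition sect :: "nat \<Rightarrow> 'a set \<Rightarrow> 'a set \<Rightarrow> 'a" where
  "sect n p v = (SOME g. g \<in> wball n \<and> g <# p = v)"

lemma sect:
  assumes "v \<in> gball n p"
  shows "sect n p v \<in> wball n" "sect n p v <# p = v"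
  using assms someI_ex[of "\<lambda>g. g \<in> wball n \<and> g <# p = v"] unfolding sect_def by blast+

lemma arr_sect:
  assumes "x \<in> X0" "p \<in> V" "agree N (lim_stab x) (stab p)" "n \<le> N" "g \<in> wball n"
  shows "arr x (sect n p (g <# p)) = arr x g"
proof -
  have v: "g <# p \<in> gball n p" using assms(5) by blast
  have "n + n \<le> 2 * N + 1" using assms(4) by simp
  then show ?thesis
    using arr_eq_agree[OF assms(1-3) sect(1)[OF v] assms(5)] sect(2)[OF v] by simp
qed

end

subsection \<open>From property A to invariant means\<close>

text \<open>Captures the squares of the property A maps at one scale: probability measures on balls
  of natural radius, with locality restated through stabilisers instead of isomorphisms.\<close>

locale local_kernel = schreier +
  fixes R :: nat and w :: "'a set \<Rightarrow> 'a set \<Rightarrow> real"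
  assumes w_supp: "p \<in> V \<Longrightarrow> w p v \<noteq> 0 \<Longrightarrow> v \<in> gball R p"
    and w_local: "p \<in> V \<Longrightarrow> p' \<in> V \<Longrightarrow> agree R (stab p) (stab p') \<Longrightarrow> g \<in> wball R
      \<Longrightarrow> w p' (g <# p') = w p (g <# p)"
    and w_nonneg: "w p v \<ge> 0"
    and w_sum: "p \<in> V \<Longrightarrow> sum (w p) (gball R p) = 1"
begin

text \<open>Transports \<open>w p\<close> to the fibre over \<open>x\<close> along
  \<open>g <# p \<mapsto> arr x g\<close>, with \<open>p = pt x R\<close>. Arrows without a
  representative of length at most \<open>R\<close> get mass 0.\<close>

definition mw :: "(nat \<Rightarrow> 'a set set) \<Rightarrow> (nat \<Rightarrow> 'a set set) \<times> 'a set \<Rightarrow> real" where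
  "mw x a = (if \<exists>g. g \<in> wball R \<and> a = arr x g
     then w (pt x R) ((SOME g. g \<in> wball R \<and> a = arr x g) <# pt x R) else 0)"

lemma mw_zero: "a \<notin> arr x ` wball R \<Longrightarrow> mw x a = 0"
  by (auto simp: mw_def)

text \<open>Locality of \<open>w\<close> makes any vertex agreeing with \<open>x\<close> usable in
  place of \<open>pt x R\<close>. A word of length up to \<open>N\<close> whose arrow is not short
  lands outside the support of \<open>w p\<close>.\<close>

lemma mw_eval:
  assumes x: "x \<in> X0" and p: "p \<in> V" and RN: "R \<le> N" and ag: "agree N (lim_stab x) (stab p)"
    and g: "g \<in> wball N"
  shows "mw x (arr x g) = w p (g <# p)"
proof -
  have eq: "arr x g = arr x h \<longleftrightarrow> g <# p = h <# p" if "h \<in> wball R" for h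
    by (rule arr_eq_agree[OF x p ag g that]) (use RN in simp)
  show ?thesis
  proof (cases "\<exists>h. h \<in> wball R \<and> arr x g = arr x h")
    case True
    define h where "h = (SOME h. h \<in> wball R \<and> arr x g = arr x h)"
    have h: "h \<in> wball R" "arr x g = arr x h" using someI_ex[OF True] by (auto simp: h_def)
    have "agree R (stab (pt x R)) (stab p)"
      using agree_mono[OF ag RN] lim_stab_agree[OF x] agree_sym agree_trans by blast
    then have "w p (h <# p) = w (pt x R) (h <# pt x R)"
      using GH0_pt(1)[OF x] p h(1) by (intro w_local)
    then show ?thesis using True h eq unfolding mw_def h_def[symmetric] by auto
  next
    case False
    then have "g <# p \<notin> gball R p" using eq by auto
    then have "w p (g <# p) = 0" using w_supp[OF p] by blast
    then show ?thesis using False by (auto simp: mw_def)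
  qed
qed

lemma mw_eval_self: "x \<in> X0 \<Longrightarrow> g \<in> wball R \<Longrightarrow> mw x (arr x g) = w (pt x R) (g <# pt x R)"
  by (rule mw_eval) (auto simp: GH0_pt lim_stab_agree)

lemma mw_nonneg: "mw x a \<ge> 0"
  by (simp add: mw_def w_nonneg)

lemma mw_has_sum:
  assumes x: "x \<in> X0" shows "(mw x has_sum 1) (fibre x)"
proof -
  have "(mw x has_sum sum (w (pt x R)) (gball R (pt x R))) (fibre x)"
    by (rule has_sum_fibre[OF x GH0_pt(1)[OF x] lim_stab_agree[OF x]]) (auto simp: mw_eval_self x mw_zero)
  then show ?thesis by (simp add: w_sum GH0_pt[OF x])
qed

lemma mw_continuous:
  assumes f: "continuous_map GT euclideanreal f"
  shows "continuous_map XT euclideanreal (\<lambda>x. \<Sum>\<^sub>\<infinity>h\<in>fibre x. f h * mw x h)"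
proof -
  \<comment> \<open>On the cylinder of \<open>x0\<close> at level \<open>R\<close> the weights are
    constant and the vertices are realised by fixed group elements, so the integral is this finite
    sum of continuous functions; the pieces are then pasted.\<close>
  define F where "F x0 x = (\<Sum>v\<in>gball R (pt x0 R). f (arr x (sect R (pt x0 R) v)) * w (pt x0 R) v)" for x0 x
  have F: "(\<Sum>\<^sub>\<infinity>h\<in>fibre x. f h * mw x h) = F x0 x" if "x \<in> X0" "x0 \<in> X0" "x R = x0 R" for x x0
  proof -
    let ?p = "pt x0 R"
    have p: "?p \<in> V" and ag: "agree R (lim_stab x) (stab ?p)"
      using that GH0_pt[OF that(2)] GH0_class_iff by auto
    have "((\<lambda>h. f h * mw x h) has_sum F x0 x) (fibre x)"
      unfolding F_def
    proof (rule has_sum_fibre[OF that(1) p ag])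
      fix g assume g: "g \<in> wball R"
      then show "f (arr x g) * mw x (arr x g) = f (arr x (sect R ?p (g <# ?p))) * w ?p (g <# ?p)"
        using mw_eval[OF that(1) p order_refl ag g] arr_sect[OF that(1) p ag order_refl g] by simp
    qed (simp add: mw_zero)
    then show ?thesis by (rule infsumI)
  qed
  show ?thesis
  proof (rule pasting_lemma[where I = X0 and T = "\<lambda>x0. {x \<in> X0. x R = x0 R}" and f = F])
    show "openin XT {x \<in> X0. x R = x0 R}" for x0 by (rule openin_cylinder)
    show "continuous_map (subtopology XT {x \<in> X0. x R = x0 R}) euclideanreal (F x0)" for x0
      unfolding F_def
    proof (intro continuous_map_from_subtopology continuous_map_sum continuous_map_real_mult)
      fix v assume "v \<in> gball R (pt x0 R)"
      then have "sect R (pt x0 R) v \<in> carrier G" using sect wball_carrier by blast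
      from continuous_map_compose[OF continuous_arr[OF this] f]
      show "continuous_map XT euclideanreal (\<lambda>x. f (arr x (sect R (pt x0 R) v)))"
        by (simp add: o_def)
    qed (simp_all add: finite_wball)
    show "F i x = F j x" if "i \<in> X0" "j \<in> X0"
        "x \<in> topspace XT \<inter> {x \<in> X0. x R = i R} \<inter> {x \<in> X0. x R = j R}" for i j x
    proof -
      have "x \<in> X0" "x R = i R" "x R = j R" using that(3) by auto
      then show ?thesis using F[of x i] F[of x j] that(1,2) by metis
    qed
    show "\<exists>j. j \<in> X0 \<and> x \<in> {x \<in> X0. x R = j R} \<and> (\<Sum>\<^sub>\<infinity>h\<in>fibre x. f h * mw x h) = F j x"
      if "x \<in> topspace XT" for x
      using F[of x x] that by auto
  qed
qed

text \<open>Translation sends \<open>arr x k\<close> to \<open>arr y (k \<otimes> inv g)\<close>,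
  where \<open>y\<close> is the translated unit. Seen from \<open>g <# p\<close> this is again
  \<open>k <# p\<close>, so the fibre sum becomes the l1-variation of \<open>w\<close> between
  \<open>g <# p\<close> and \<open>p\<close>.\<close>

lemma mw_invariance:
  assumes x: "x \<in> X0" and g: "g \<in> wball n"
    and bd: "\<And>p. p \<in> V \<Longrightarrow>
      (\<Sum>v\<in>gball (R + n) p. \<bar>w (g <# p) v - w p v\<bar>) \<le> C"
  shows "(\<Sum>\<^sub>\<infinity>h\<in>fibre x. \<bar>mw (GH_act G Q H g x) (GH_mult G (GH_inv G Q H (arr x g)) h) - mw x h\<bar>) \<le> C"
proof -
  let ?y = "GH_act G Q H g x" and ?N = "R + n"
  \<comment> \<open>Words \<open>k \<otimes> inv g\<close> have length at most
    \<open>?N + n\<close>, and passing from \<open>x\<close> to the translated unit loses another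
    \<open>n\<close> levels.\<close>
  define M where "M = ?N + n + n"
  define p where "p = pt x M"
  have gc: "g \<in> carrier G" using g by (rule wball_carrier)
  have p: "p \<in> V" and agM: "agree M (lim_stab x) (stab p)"
    unfolding p_def using GH0_pt[OF x] lim_stab_agree[OF x] by auto
  have y: "?y \<in> X0" using GH_act_GH0[OF x gc] .
  have agy: "agree (?N + n) (lim_stab ?y) (stab (g <# p))"
    unfolding agree_iff
  proof
    fix h assume h: "h \<in> wball (2 * (?N + n) + 1)"
    have "inv g \<otimes> h \<otimes> g \<in> wball (n + (2 * (?N + n) + 1) + n)"
      using g h by (intro wball_mult wball_inv)
    then have "inv g \<otimes> h \<otimes> g \<in> lim_stab x \<longleftrightarrow> inv g \<otimes> h \<otimes> g \<in> stab p"
      by (rule agreeD[OF agM]) (simp add: M_def)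
    then show "h \<in> lim_stab ?y \<longleftrightarrow> h \<in> stab (g <# p)"
      by (simp add: lim_stab_act[OF x gc] stab_act[OF p gc])
  qed
  let ?F = "\<lambda>h. \<bar>mw ?y (GH_mult G (GH_inv G Q H (arr x g)) h) - mw x h\<bar>"
  let ?f = "\<lambda>v. \<bar>w (g <# p) v - w p v\<bar>"
  have Fk: "?F (arr x k) = \<bar>mw ?y (arr ?y (k \<otimes> inv g)) - mw x (arr x k)\<bar>" if "k \<in> carrier G" for k
    using that x gc by (simp add: mult_inv_arr)
  have "(?F has_sum sum ?f (gball ?N p)) (fibre x)"
  proof (rule has_sum_fibre[OF x p])
    show "agree ?N (lim_stab x) (stab p)" using agM by (rule agree_mono) (simp add: M_def)
  next
    fix k assume k: "k \<in> wball ?N"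
    have kc: "k \<in> carrier G" using k by (rule wball_carrier)
    have "k \<otimes> inv g \<in> wball (?N + n)" using k g by (intro wball_mult wball_inv)
    then have "mw ?y (arr ?y (k \<otimes> inv g)) = w (g <# p) ((k \<otimes> inv g) <# (g <# p))"
      using y p gc agy by (intro mw_eval) auto
    also have "(k \<otimes> inv g) <# (g <# p) = k <# p" using kc gc p by (simp add: act_act m_assoc)
    finally have 1: "mw ?y (arr ?y (k \<otimes> inv g)) = w (g <# p) (k <# p)" .
    have "k \<in> wball M" using k by (rule wball_mono) (simp add: M_def)
    then have "mw x (arr x k) = w p (k <# p)"
      using x p agM by (intro mw_eval[of _ _ M]) (auto simp: M_def)
    then show "?F (arr x k) = ?f (k <# p)" using 1 Fk[OF kc] by simp
  next
    fix k assume k: "k \<in> carrier G" "arr x k \<notin> arr x ` wball ?N"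
    have "arr x k \<notin> arr x ` wball R" using k(2) wball_mono[of _ R ?N] by auto
    then have 1: "mw x (arr x k) = 0" by (rule mw_zero)
    \<comment> \<open>A short representative \<open>h\<close> of the translated arrow would give the
      representative \<open>h \<otimes> g\<close> of \<open>arr x k\<close>, of length at most
      \<open>R + n\<close>.\<close>
    have "arr ?y (k \<otimes> inv g) \<notin> arr ?y ` wball R"
    proof
      assume "arr ?y (k \<otimes> inv g) \<in> arr ?y ` wball R"
      then obtain h where h: "h \<in> wball R" "arr ?y (k \<otimes> inv g) = arr ?y h" by blast
      have hc: "h \<in> carrier G" using h(1) by (rule wball_carrier)
      have "inv h \<otimes> (k \<otimes> inv g) \<in> lim_stab ?y"
        using arr_eq_iff[OF y, of h "k \<otimes> inv g"] h k gc hc by simp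
      then have "inv (h \<otimes> g) \<otimes> k \<in> lim_stab x"
        using lim_stab_act[OF x gc] k gc hc by (simp add: m_assoc inv_mult_group)
      then have "arr x (h \<otimes> g) = arr x k" using arr_eq_iff[OF x] hc gc k by simp
      moreover have "h \<otimes> g \<in> wball ?N" using h g by (intro wball_mult)
      ultimately show False using k(2) by (metis image_eqI)
    qed
    then have "mw ?y (arr ?y (k \<otimes> inv g)) = 0" by (rule mw_zero)
    then show "?F (arr x k) = 0" using 1 Fk[OF k(1)] by simp
  qed
  from infsumI[OF this] show ?thesis using bd[OF p] by simp
qed


end

section \<open>Local kernels from property A\<close>

context schreier begin

lemma finite_gball [simp]: "finite (gball n p)"
  by (simp add: finite_wball)

text \<open>Property A at the single scale \<open>n\<close>. Scales do not interact, so the maps can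
  be built one at a time and assembled by choice.\<close>

definition property_A_at :: "nat \<Rightarrow> ('a set \<Rightarrow> 'a set \<Rightarrow> real) \<Rightarrow> bool" where
  "property_A_at n \<rho> \<longleftrightarrow>
        (\<forall>x\<in>V. (\<forall>v. \<rho> x v \<noteq> 0 \<longrightarrow> v \<in> V) \<and> l2norm (\<rho> x) = 1) \<and>
        (\<forall>x\<in>V. \<forall>y\<in>V. sdist G Q x y \<le> n \<longrightarrow> l2norm (\<lambda>v. \<rho> x v - \<rho> y v) \<le> 1 / real n) \<and>
        (\<exists>R::real. R > 0 \<and>
           (\<forall>x\<in>V. \<forall>v. \<rho> x v \<noteq> 0 \<longrightarrow> v \<in> sball G Q H R x) \<and>
           (\<forall>x\<in>V. \<forall>y\<in>V. \<forall>\<theta>. rl_iso G Q H R x y \<theta> \<longrightarrow>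
               (\<forall>v\<in>sball G Q H R x. \<rho> y (\<theta> v) = \<rho> x v)))"

lemma local_property_A_iff:
  "local_property_A G Q H \<longleftrightarrow> (\<exists>\<rho>. \<forall>n\<ge>1. property_A_at n (\<rho> n))"
  unfolding local_property_A_def property_A_at_def ..

lemma property_A_kernel:
  assumes "local_property_A G Q H" "n \<ge> 1"
  obtains R w where "local_kernel G Q H R w"
    "\<And>p g. p \<in> V \<Longrightarrow> g \<in> wball n \<Longrightarrow>
      (\<Sum>v\<in>gball (R + n) p. \<bar>w (g <# p) v - w p v\<bar>) \<le> 2 / real n"
proof -
  obtain r where "property_A_at n r"
    using assms unfolding local_property_A_iff by blast
  note props = this[unfolded property_A_at_def]
  have nrm: "\<And>x. x \<in> V \<Longrightarrow> l2norm (r x) = 1"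
    using conjunct1[OF props] by blast
  have var: "\<And>x y. x \<in> V \<Longrightarrow> y \<in> V \<Longrightarrow> sdist G Q x y \<le> n \<Longrightarrow>
      l2norm (\<lambda>v. r x v - r y v) \<le> 1 / real n"
    using conjunct1[OF conjunct2[OF props]] by blast
  obtain R :: real where R: "R > 0 \<and>
      (\<forall>x\<in>V. \<forall>v. r x v \<noteq> 0 \<longrightarrow> v \<in> sball G Q H R x) \<and>
      (\<forall>x\<in>V. \<forall>y\<in>V. \<forall>\<theta>. rl_iso G Q H R x y \<theta> \<longrightarrow>
         (\<forall>v\<in>sball G Q H R x. r y (\<theta> v) = r x v))"
    using conjunct2[OF conjunct2[OF props]] by (rule exE)
  have supp: "\<And>x v. x \<in> V \<Longrightarrow> r x v \<noteq> 0 \<Longrightarrow> v \<in> sball G Q H R x"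
    using R by blast
  have loc: "\<And>x y \<theta> v. x \<in> V \<Longrightarrow> y \<in> V \<Longrightarrow> rl_iso G Q H R x y \<theta> \<Longrightarrow> v \<in> sball G Q H R x
      \<Longrightarrow> r y (\<theta> v) = r x v"
    using R by blast
  have R: "R > 0" using R by blast
  define m where "m = nat \<lfloor>R\<rfloor>"
  have sb: "sball G Q H R x = gball m x" if "x \<in> V" for x
    using sball_eq[OF that] R by (simp add: m_def)
  define w where "w x v = (r x v)\<^sup>2" for x v
  have r0: "r x v = 0" if "x \<in> V" "v \<notin> gball m x" for x v
    using supp[OF that(1)] that(2) sb[OF that(1)] by blast
  have "local_kernel G Q H m w"
  proof unfold_locales
    fix p v assume "p \<in> V" "w p v \<noteq> 0"
    then show "v \<in> gball m p" using r0 by (auto simp: w_def)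
  next
    fix p p' g assume *: "p \<in> V" "p' \<in> V" "agree m (stab p) (stab p')" "g \<in> wball m"
    then obtain \<theta> where \<theta>: "rl_iso G Q H R p p' \<theta>"
      using agree_imp_rl_iso[of p p' R] R by (auto simp: m_def)
    have "\<theta> (g <# p) = g <# p'"
      using rl_iso_act[OF *(1,2) _ \<theta>] * R by (simp add: m_def)
    then show "w p' (g <# p') = w p (g <# p)"
      using loc[OF *(1,2) \<theta>, of "g <# p"] * sb by (simp add: w_def)
  next
    fix p assume p: "p \<in> V"
    have "l2norm (r p) = L2_set (r p) (gball m p)"
      by (rule l2norm_finite) (use r0 p in auto)
    then show "sum (w p) (gball m p) = 1" using nrm[OF p] by (simp add: L2_set_def w_def)
  qed (simp add: w_def)
  moreover have "(\<Sum>v\<in>gball (m + n) p. \<bar>w (g <# p) v - w p v\<bar>) \<le> 2 / real n"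
    if p: "p \<in> V" and g: "g \<in> wball n" for p g
  proof -
    have gc: "g \<in> carrier G" using g by (rule wball_carrier)
    have q: "g <# p \<in> V" using gc p by auto
    \<comment> \<open>Large enough to contain the supports of both \<open>r p\<close> and
      \<open>r (g <# p)\<close>.\<close>
    let ?F = "gball (m + n) p"
    have 1: "r p v = 0" if "v \<notin> ?F" for v
      using that r0[OF p] wball_mono[of _ m "m + n"] by fastforce
    have 2: "r (g <# p) v = 0" if "v \<notin> ?F" for v
    proof (rule r0[OF q])
      show "v \<notin> gball m (g <# p)"
      proof
        assume "v \<in> gball m (g <# p)"
        then obtain h where h: "h \<in> wball m" "v = h <# (g <# p)" by blast
        then have "v = (h \<otimes> g) <# p" using gc p by (simp add: act_act wball_carrier)
        moreover have "h \<otimes> g \<in> wball (m + n)" using h g by (intro wball_mult)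
        ultimately show False using that by blast
      qed
    qed
    have d: "sdist G Q (g <# p) p \<le> n"
      using gc p g by (subst sdist_le_iff[OF q p]) (auto simp: act_act intro!: bexI[of _ "inv g"] wball_inv)
    have "(\<Sum>v\<in>?F. \<bar>w (g <# p) v - w p v\<bar>)
        \<le> L2_set (\<lambda>v. r (g <# p) v - r p v) ?F * (L2_set (r (g <# p)) ?F + L2_set (r p) ?F)"
      unfolding w_def by (rule sum_abs_diff_squares_le) simp
    also have "\<dots> = l2norm (\<lambda>v. r (g <# p) v - r p v) * (l2norm (r (g <# p)) + l2norm (r p))"
      using 1 2 by (simp add: l2norm_finite[of ?F])
    also have "\<dots> \<le> 1 / real n * (1 + 1)"
      using var[OF q p d] nrm[OF p] nrm[OF q] by (intro mult_mono) auto
    finally show ?thesis by simp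
  qed
  ultimately show thesis by (rule that)
qed

lemma property_A_imp_amenable:
  assumes A: "local_property_A G Q H"
  shows "GH_top_amenable G Q H"
  unfolding GH_top_amenable_def top_amenable_def
proof (intro allI impI, elim conjE)
  fix K and \<epsilon> :: real assume K: "compactin GT K" and \<epsilon>: "\<epsilon> > 0"
  obtain k where k: "K \<subseteq> tube k" using compactin_subset_tube[OF K] by blast
  obtain l where l: "2 / \<epsilon> < real l" using reals_Archimedean2 by blast
  \<comment> \<open>The bound \<open>k\<close> gives every arrow of \<open>K\<close> a
    representative of length at most \<open>n\<close>, and \<open>l\<close> makes
    \<open>2 / n\<close> smaller than \<open>\<epsilon>\<close>.\<close>
  define n where "n = max 1 (max k l)"
  have n: "n \<ge> 1" "k \<le> n" "2 / real n < \<epsilon>"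
  proof -
    have "2 / \<epsilon> < real n" using l by (simp add: n_def)
    then show "2 / real n < \<epsilon>" using \<epsilon> by (simp add: field_simps n_def)
  qed (auto simp: n_def)
  obtain R w where w: "local_kernel G Q H R w"
    and bd: "\<And>p g. p \<in> V \<Longrightarrow> g \<in> wball n \<Longrightarrow>
      (\<Sum>v\<in>gball (R + n) p. \<bar>w (g <# p) v - w p v\<bar>) \<le> 2 / real n"
    using property_A_kernel[OF A n(1)] by blast
  interpret local_kernel G Q H R w by (rule w)
  show "\<exists>m. (\<forall>x\<in>topspace XT. (\<forall>g. 0 \<le> m x g) \<and> (\<forall>g. m x g \<noteq> 0 \<longrightarrow> g \<in> topspace GT \<and> GH_r g = x) \<and>
               (m x has_sum 1) (fibre x)) \<and>
         (\<forall>f. continuous_map GT euclideanreal f \<and>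
              compactin GT (GT closure_of {g \<in> topspace GT. f g \<noteq> 0}) \<longrightarrow>
              continuous_map XT euclideanreal (\<lambda>x. \<Sum>\<^sub>\<infinity>g\<in>fibre x. f g * m x g)) \<and>
         (\<forall>\<gamma>\<in>K. (\<Sum>\<^sub>\<infinity>h\<in>fibre (GH_r \<gamma>).
             \<bar>m (GH_s G Q H \<gamma>) (GH_mult G (GH_inv G Q H \<gamma>) h) - m (GH_r \<gamma>) h\<bar>) < \<epsilon>)"
  proof (rule exI[of _ mw], intro conjI ballI)
    show "\<forall>g. mw x g \<noteq> 0 \<longrightarrow> g \<in> topspace GT \<and> GH_r g = x" if "x \<in> topspace XT" for x
    proof (intro allI impI)
      fix a assume "mw x a \<noteq> 0"
      then obtain g where "g \<in> wball R" "a = arr x g" using mw_zero by blast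
      then show "a \<in> topspace GT \<and> GH_r a = x" using that arr_GH wball_carrier by simp
    qed
  next
    fix \<gamma> assume "\<gamma> \<in> K"
    then obtain x g where g: "\<gamma> = arr x g" "x \<in> X0" "g \<in> wball k" using k by (auto simp: tube_eq)
    then have gn: "g \<in> wball n" using n(2) wball_mono by blast
    have "(\<Sum>\<^sub>\<infinity>h\<in>fibre x. \<bar>mw (GH_act G Q H g x) (GH_mult G (GH_inv G Q H (arr x g)) h) - mw x h\<bar>) \<le> 2 / real n"
      by (rule mw_invariance[OF g(2) gn]) (rule bd[OF _ gn])
    then show "(\<Sum>\<^sub>\<infinity>h\<in>fibre (GH_r \<gamma>). \<bar>mw (GH_s G Q H \<gamma>) (GH_mult G (GH_inv G Q H \<gamma>) h) - mw (GH_r \<gamma>) h\<bar>) < \<epsilon>"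
      using n(3) g wball_carrier[OF gn] by (simp add: GH_s_arr)
  qed (auto simp: mw_nonneg mw_has_sum mw_continuous simp del: topspace_GT)
qed


subsection \<open>From invariant means to property A\<close>

lemma XT_continuous_local:
  fixes h :: "(nat \<Rightarrow> 'a set set) \<Rightarrow> real"
  assumes h: "continuous_map XT euclideanreal h" and x: "x \<in> X0" and e: "e > 0"
  shows "\<exists>M. \<forall>y\<in>X0. y M = x M \<longrightarrow> \<bar>h y - h x\<bar> < e"
proof -
  have "openin XT {y \<in> topspace XT. h y \<in> ball (h x) e}"
    by (rule openin_continuous_map_preimage[OF h]) auto
  then show ?thesis using x e unfolding openin_XT_iff
    by (auto simp: dist_real_def abs_minus_commute)
qed

text \<open>Heine--Cantor on the unit space. The property made uniform is the variation of
  \<open>h\<close> on the cylinder of each point; the halved tolerance pays for comparing through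
  the centre \<open>x\<close>.\<close>

lemma XT_continuous_uniform:
  fixes h :: "(nat \<Rightarrow> 'a set set) \<Rightarrow> real"
  assumes h: "continuous_map XT euclideanreal h" and e: "e > 0"
  shows "\<exists>N. \<forall>x\<in>X0. \<forall>y\<in>X0. y N = x N \<longrightarrow> \<bar>h y - h x\<bar> < e"
proof (rule uniformly_on_GH0)
  fix x assume x: "x \<in> X0"
  obtain M where M: "\<And>y. y \<in> X0 \<Longrightarrow> y M = x M \<Longrightarrow> \<bar>h y - h x\<bar> < e / 2"
    using XT_continuous_local[OF h x, of "e / 2"] e by auto
  have "\<bar>h z - h y\<bar> < e" if "y \<in> X0" "y M = x M" "z \<in> X0" "z M = y M" for y z
  proof -
    have "\<bar>h y - h x\<bar> < e / 2" "\<bar>h z - h x\<bar> < e / 2" using M that by auto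
    then show ?thesis unfolding abs_less_iff by linarith
  qed
  then show "\<exists>M. \<forall>y\<in>X0. y M = x M \<longrightarrow> (\<forall>z\<in>X0. z M = y M \<longrightarrow> \<bar>h z - h y\<bar> < e)" by blast
next
  fix M N y assume y: "y \<in> X0" "\<forall>z\<in>X0. z M = y M \<longrightarrow> \<bar>h z - h y\<bar> < e" "M \<le> N"
  then show "\<forall>z\<in>X0. z N = y N \<longrightarrow> \<bar>h z - h y\<bar> < e" using GH0_coord_mono by blast
qed

lemma XT_continuous_uniform_finite:
  fixes h :: "'c \<Rightarrow> (nat \<Rightarrow> 'a set set) \<Rightarrow> real"
  assumes "finite I" and h: "\<And>i. i \<in> I \<Longrightarrow> continuous_map XT euclideanreal (h i)" and e: "e > 0"
  shows "\<exists>N\<ge>N0. \<forall>i\<in>I. \<forall>x\<in>X0. \<forall>y\<in>X0. y N = x N \<longrightarrow> \<bar>h i y - h i x\<bar> < e"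
  using assms(1) h
proof (induction I)
  case (insert i I)
  obtain N where N: "N \<ge> N0" "\<And>j x y. \<lbrakk>j \<in> I; x \<in> X0; y \<in> X0; y N = x N\<rbrakk> \<Longrightarrow> \<bar>h j y - h j x\<bar> < e"
    using insert.IH[OF insert.prems[OF insertI2]] by auto
  obtain M where M: "\<And>x y. \<lbrakk>x \<in> X0; y \<in> X0; y M = x M\<rbrakk> \<Longrightarrow> \<bar>h i y - h i x\<bar> < e"
    using XT_continuous_uniform[OF insert.prems[OF insertI1] e] by auto
  have "\<bar>h j y - h j x\<bar> < e" if "j \<in> insert i I" "x \<in> X0" "y \<in> X0" "y (max M N) = x (max M N)" for j x y
  proof -
    have "y M = x M" "y N = x N"
      using GH0_coord_mono[OF that(3,2,4)] by auto
    then show ?thesis using that M N by blast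
  qed
  then show ?case using N(1) by (intro exI[of _ "max M N"]) auto
qed auto

section \<open>Densities of a mean and their uniform tightness\<close>

lemma continuous_map_indicator_bisec:
  assumes "g \<in> carrier G"
  shows "continuous_map GT euclideanreal (indicat_real (bisec g))"
  unfolding continuous_map_def
proof (intro conjI allI impI)
  fix U :: "real set"
  have "{x \<in> topspace GT. indicat_real (bisec g) x \<in> U} =
     (if 1 \<in> U then bisec g else {}) \<union> (if 0 \<in> U then topspace GT - bisec g else {})"
    using openin_subset[OF openin_bisec[OF assms]] by (auto simp: indicator_def simp del: topspace_GT)
  also have "openin GT \<dots>"
    using openin_bisec[OF assms] closedin_bisec[OF assms] by (intro openin_Un) (auto simp del: topspace_GT)
  finally show "openin GT {x \<in> topspace GT. indicat_real (bisec g) x \<in> U}" .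
qed auto

text \<open>The indicator of a compact clopen bisection is a continuous compactly supported test
  function, and its integral over a fibre is a single density.\<close>

lemma density_continuous:
  fixes m :: "(nat \<Rightarrow> 'a set set) \<Rightarrow> (nat \<Rightarrow> 'a set set) \<times> 'a set \<Rightarrow> real"
  assumes cont: "\<And>f. \<lbrakk>continuous_map GT euclideanreal f;
        compactin GT (GT closure_of {g \<in> topspace GT. f g \<noteq> 0})\<rbrakk> \<Longrightarrow>
        continuous_map XT euclideanreal (\<lambda>x. \<Sum>\<^sub>\<infinity>g\<in>fibre x. f g * m x g)"
    and g: "g \<in> carrier G"
  shows "continuous_map XT euclideanreal (\<lambda>x. m x (arr x g))"
proof -
  let ?f = "indicat_real (bisec g)"
  have "{a \<in> topspace GT. ?f a \<noteq> 0} = bisec g"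
    using openin_subset[OF openin_bisec[OF g]] by (auto simp: indicator_def simp del: topspace_GT)
  then have "continuous_map XT euclideanreal (\<lambda>x. \<Sum>\<^sub>\<infinity>a\<in>fibre x. ?f a * m x a)"
    using closure_of_closedin[OF closedin_bisec[OF g]] compactin_bisec[OF g]
    by (intro cont continuous_map_indicator_bisec g) simp
  moreover have "(\<Sum>\<^sub>\<infinity>a\<in>fibre x. ?f a * m x a) = m x (arr x g)" if x: "x \<in> X0" for x
  proof -
    have "(\<Sum>\<^sub>\<infinity>a\<in>fibre x. ?f a * m x a) = (\<Sum>\<^sub>\<infinity>a\<in>{arr x g}. ?f a * m x a)"
      by (rule infsum_cong_neutral) (use x g arr_GH in \<open>auto simp: bisec_def indicator_def\<close>)
    then show ?thesis using x by (simp add: bisec_def)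
  qed
  ultimately show ?thesis
    by (rule continuous_map_eq) simp
qed

text \<open>A Dini argument: masses of growing balls increase to 1 on each fibre, and each ball mass
  is locally a continuous function, so compactness gives one radius for all units.\<close>

lemma fibre_mass_tight:
  fixes m :: "(nat \<Rightarrow> 'a set set) \<Rightarrow> (nat \<Rightarrow> 'a set set) \<times> 'a set \<Rightarrow> real"
  assumes nn: "\<And>x a. x \<in> X0 \<Longrightarrow> m x a \<ge> 0"
    and sum1: "\<And>x. x \<in> X0 \<Longrightarrow> (m x has_sum 1) (fibre x)"
    and cont: "\<And>g. g \<in> carrier G \<Longrightarrow> continuous_map XT euclideanreal (\<lambda>x. m x (arr x g))"
    and d: "d > 0"
  shows "\<exists>R. \<forall>x\<in>X0. sum (m x) (arr x ` wball R) > 1 - d"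
proof (rule uniformly_on_GH0)
  have mono: "sum (m y) (arr y ` wball M) \<le> sum (m y) (arr y ` wball N)" if "y \<in> X0" "M \<le> N" for y M N
    using that finite_wball nn wball_mono by (intro sum_mono2) auto
  then show "1 - d < sum (m y) (arr y ` wball N)"
    if "y \<in> X0" "1 - d < sum (m y) (arr y ` wball M)" "M \<le> N" for y M N
    using that by (meson less_le_trans)
  fix x assume x: "x \<in> X0"
  have "d / 2 > 0" using d by simp
  from has_sum_finite_approximation[OF sum1[OF x] this]
  obtain F where F: "finite F" "F \<subseteq> fibre x" "dist (sum (m x) F) 1 \<le> d / 2" by blast
  obtain C where C: "finite C" "C \<subseteq> carrier G" "F = arr x ` C"
    using finite_subset_image[OF F(1), of "arr x" "carrier G"] F(2) unfolding fibre_eq[OF x] by blast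
  obtain R where R: "\<And>g. g \<in> C \<Longrightarrow> wlen G Q g \<le> R"
    using finite_nat_set_iff_bounded_le[of "wlen G Q ` C"] C(1) by auto
  have "C \<subseteq> wball R" using R C(2) by (auto simp: wball_def)
  then have "sum (m x) F \<le> sum (m x) (arr x ` wball R)"
    unfolding C(3) using finite_wball nn[OF x] by (intro sum_mono2) auto
  then have big: "sum (m x) (arr x ` wball R) > 1 - d" using F(3) d
    unfolding dist_real_def abs_le_iff by linarith
  let ?p = "pt x R"
  \<comment> \<open>The number of distinct short arrows varies with the unit. Indexing by the
    vertices around the fixed \<open>?p\<close> gives a continuous function that equals the ball
    mass on the cylinder of \<open>x\<close>.\<close>
  define h where "h y = (\<Sum>v\<in>gball R ?p. m y (arr y (sect R ?p v)))" for y
  have p: "?p \<in> V" using GH0_pt[OF x] by blast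
  have h: "sum (m y) (arr y ` wball R) = h y" if y: "y \<in> X0" "y R = x R" for y
  proof -
    have ag: "agree R (lim_stab y) (stab ?p)" using GH0_class_iff[OF y(1) p] y(2) GH0_pt[OF x] by auto
    show ?thesis unfolding h_def
      by (rule sum_arr_gball[OF y(1) p ag]) (simp add: arr_sect[OF y(1) p ag])
  qed
  have "continuous_map XT euclideanreal h"
    unfolding h_def by (intro continuous_map_sum cont) (auto intro: wball_carrier sect)
  moreover have "h x - (1 - d) > 0" using big h[OF x] by simp
  ultimately obtain M where M: "\<And>y. y \<in> X0 \<Longrightarrow> y M = x M \<Longrightarrow> \<bar>h y - h x\<bar> < h x - (1 - d)"
    using XT_continuous_local[OF _ x] by meson
  have "1 - d < sum (m y) (arr y ` wball (max M R))"
    if y: "y \<in> X0" "y (max M R) = x (max M R)" for y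
  proof -
    have "y M = x M" "y R = x R" using GH0_coord_mono[OF y(1) x y(2)] by auto
    then have "h y > 1 - d" using M[OF y(1)] by linarith
    then have "1 - d < sum (m y) (arr y ` wball R)" using h[OF y(1)] \<open>y R = x R\<close> by simp
    also have "\<dots> \<le> sum (m y) (arr y ` wball (max M R))" using mono y(1) by simp
    finally show ?thesis .
  qed
  then show "\<exists>M. \<forall>y\<in>X0. y M = x M \<longrightarrow> 1 - d < sum (m y) (arr y ` wball M)" by blast
qed

end

section \<open>Truncating the mean to local densities\<close>

lemma sqrt_diff_square_le:
  fixes a b :: real
  assumes "a \<ge> 0" "b \<ge> 0"
  shows "(sqrt a - sqrt b)\<^sup>2 \<le> \<bar>a - b\<bar>"
proof -
  have "(sqrt a - sqrt b)\<^sup>2 = \<bar>sqrt a - sqrt b\<bar> * \<bar>sqrt a - sqrt b\<bar>"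
    by (simp add: power2_eq_square)
  also have "\<dots> \<le> \<bar>sqrt a - sqrt b\<bar> * \<bar>sqrt a + sqrt b\<bar>"
    using real_sqrt_ge_zero[OF assms(1)] real_sqrt_ge_zero[OF assms(2)]
    by (intro mult_left_mono) linarith+
  also have "\<dots> = \<bar>(sqrt a - sqrt b) * (sqrt a + sqrt b)\<bar>"
    by (simp only: abs_mult)
  also have "(sqrt a - sqrt b) * (sqrt a + sqrt b) = a - b"
    using assms by (simp add: algebra_simps)
  finally show ?thesis .
qed

text \<open>The mean is cut to radius \<open>R\<close> with loss below \<open>d\<close>, then frozen
  on cylinders of level \<open>N\<close>; the tolerance per arrow keeps the total freezing error at
  most \<open>d\<close>. The bound \<open>1 / 4\<close> keeps the normalising constants
  positive.\<close>

locale truncated_mean = schreier +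
  fixes m :: "(nat \<Rightarrow> 'a set set) \<Rightarrow> (nat \<Rightarrow> 'a set set) \<times> 'a set \<Rightarrow> real"
    and n R N :: nat and d e :: real
  assumes m_nonneg: "x \<in> X0 \<Longrightarrow> m x a \<ge> 0"
    and m_sum: "x \<in> X0 \<Longrightarrow> (m x has_sum 1) (fibre x)"
    and m_inv: "x \<in> X0 \<Longrightarrow> g \<in> wball n \<Longrightarrow>
      (\<Sum>\<^sub>\<infinity>h\<in>fibre x. \<bar>m (GH_act G Q H g x) (GH_mult G (GH_inv G Q H (arr x g)) h) - m x h\<bar>) < e"
    and tight: "x \<in> X0 \<Longrightarrow> sum (m x) (arr x ` wball R) > 1 - d"
    and unif: "\<lbrakk>g \<in> wball R; x \<in> X0; y \<in> X0; y N = x N\<rbrakk> \<Longrightarrow>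
      \<bar>m y (arr y g) - m x (arr x g)\<bar> < d / real (card (wball R))"
    and RN: "R \<le> N" and d: "0 < d" "d \<le> 1 / 4"
begin

text \<open>Unlike in \<open>sect\<close>, no length bound is imposed, so every vertex is
  reached.\<close>

definition vec :: "'a set \<Rightarrow> 'a set \<Rightarrow> 'a" where
  "vec p v = (SOME g. g \<in> carrier G \<and> g <# p = v)"

text \<open>Identifies the vertices with the range fibre over \<open>vx p\<close>, by
  \<open>g <# p \<mapsto> arr (vx p) g\<close>.\<close>

definition pair_arr :: "'a set \<Rightarrow> 'a set \<Rightarrow> (nat \<Rightarrow> 'a set set) \<times> 'a set" where
  "pair_arr p v = arr (vx p) (vec p v)"

definition base_mass :: "'a set \<Rightarrow> 'a set \<Rightarrow> real" where
  "base_mass p v = m (vx p) (pair_arr p v)"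

text \<open>Evaluating the mean at \<open>repr p\<close>, which depends only on the \<open>N\<close>-ball around \<open>p\<close>, instead of at
  \<open>vx p\<close> itself is what makes the truncated densities local.\<close>

definition repr :: "'a set \<Rightarrow> nat \<Rightarrow> 'a set set" where
  "repr p = (SOME x. x \<in> X0 \<and> x N = vx p N)"

definition near_mass :: "'a set \<Rightarrow> 'a set \<Rightarrow> real" where
  "near_mass p v = (if v \<in> gball R p then m (repr p) (arr (repr p) (sect R p v)) else 0)"

definition total :: "'a set \<Rightarrow> real" where
  "total p = sum (near_mass p) (gball R p)"

definition \<rho> :: "'a set \<Rightarrow> 'a set \<Rightarrow> real" where
  "\<rho> p v = sqrt (near_mass p v / total p)"

lemma vec:
  assumes "p \<in> V" "v \<in> V" shows "vec p v \<in> carrier G" "vec p v <# p = v"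
  using V_trans[OF assms] someI_ex[of "\<lambda>g. g \<in> carrier G \<and> g <# p = v"] unfolding vec_def by blast+

lemma pair_arr_eq:
  assumes "p \<in> V" "v \<in> V" "g \<in> carrier G" "g <# p = v"
  shows "pair_arr p v = arr (vx p) g"
  using assms vec[OF assms(1,2)]
  by (simp add: pair_arr_def arr_eq_iff vx_GH0 lim_stab_vx flip: act_eq_iff)

lemma pair_arr_inj: "p \<in> V \<Longrightarrow> inj_on (pair_arr p) V"
  unfolding inj_on_def pair_arr_def
  by (metis arr_eq_iff vx_GH0 lim_stab_vx act_eq_iff vec)

lemma pair_arr_image: "p \<in> V \<Longrightarrow> pair_arr p ` V = fibre (vx p)"
proof
  assume p: "p \<in> V"
  show "pair_arr p ` V \<subseteq> fibre (vx p)"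
    using p vec unfolding fibre_eq[OF vx_GH0[OF p]] pair_arr_def by blast
  show "fibre (vx p) \<subseteq> pair_arr p ` V"
    unfolding fibre_eq[OF vx_GH0[OF p]] using p pair_arr_eq[OF p] act_V by (metis image_subsetI image_eqI)
qed

lemma base_mass_nonneg: "p \<in> V \<Longrightarrow> base_mass p v \<ge> 0"
  by (simp add: base_mass_def m_nonneg vx_GH0)

lemma gball_V: "p \<in> V \<Longrightarrow> gball k p \<subseteq> V"
  using wball_carrier by auto

lemma sum_base_mass_le:
  assumes p: "p \<in> V" and F: "finite F" "F \<subseteq> V"
  shows "sum (base_mass p) F \<le> 1"
proof -
  have "sum (base_mass p) F = sum (m (vx p)) (pair_arr p ` F)"
    using inj_on_subset[OF pair_arr_inj[OF p] F(2)] by (simp add: sum.reindex base_mass_def)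
  also have "\<dots> \<le> 1"
    using F pair_arr_image[OF p] m_nonneg[OF vx_GH0[OF p]]
    by (intro finite_sum_le_has_sum[OF m_sum[OF vx_GH0[OF p]]]) auto
  finally show ?thesis .
qed

lemma sum_base_mass_gball:
  assumes p: "p \<in> V" shows "sum (base_mass p) (gball R p) > 1 - d"
proof -
  have "sum (m (vx p)) (arr (vx p) ` wball R) = sum (base_mass p) (gball R p)"
  proof (rule sum_arr_gball[OF vx_GH0[OF p] p])
    fix g assume "g \<in> wball R"
    then show "m (vx p) (arr (vx p) g) = base_mass p (g <# p)"
      using pair_arr_eq[OF p, of "g <# p" g] p wball_carrier by (simp add: base_mass_def)
  qed (simp add: lim_stab_vx p)
  then show ?thesis using tight[OF vx_GH0[OF p]] by simp
qed

text \<open>In vertex coordinates translation is invisible: \<open>pair_arr p v\<close> goes to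
  \<open>pair_arr (g <# p) v\<close>, because \<open>vec p v \<otimes> inv g\<close> carries
  \<open>g <# p\<close> to \<open>v\<close>.\<close>

lemma base_mass_invariant:
  assumes p: "p \<in> V" and g: "g \<in> wball n" and F: "finite F" "F \<subseteq> V"
  shows "(\<Sum>v\<in>F. \<bar>base_mass (g <# p) v - base_mass p v\<bar>) \<le> e"
proof -
  have gc: "g \<in> carrier G" using g by (rule wball_carrier)
  have q: "g <# p \<in> V" using gc p by auto
  let ?D = "\<lambda>h. \<bar>m (GH_act G Q H g (vx p)) (GH_mult G (GH_inv G Q H (arr (vx p) g)) h) - m (vx p) h\<bar>"
  have D: "?D (pair_arr p v) = \<bar>base_mass (g <# p) v - base_mass p v\<bar>" if v: "v \<in> V" for v
  proof -
    have k: "vec p v \<in> carrier G" "vec p v <# p = v" using vec p v by blast+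
    have "GH_mult G (GH_inv G Q H (arr (vx p) g)) (pair_arr p v) = arr (vx (g <# p)) (vec p v \<otimes> inv g)"
      using k gc p by (simp add: pair_arr_def mult_inv_arr vx_GH0 act_vx)
    also have "\<dots> = pair_arr (g <# p) v"
      using k gc p v q by (intro pair_arr_eq[symmetric]) (auto simp: act_act m_assoc)
    finally show ?thesis using p gc by (simp add: base_mass_def act_vx)
  qed
  have sumD: "sum ?D (pair_arr p ` F) = (\<Sum>v\<in>F. \<bar>base_mass (g <# p) v - base_mass p v\<bar>)" if "F \<subseteq> V" for F
    using inj_on_subset[OF pair_arr_inj[OF p] that] D that by (subst sum.reindex) (auto intro!: sum.cong)
  \<comment> \<open>A non-summable \<open>infsum\<close> is 0 by convention, so \<open>m_inv\<close>
    bounds finite partial sums only once summability is known. Partial sums are at most 2, the two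
    total masses.\<close>
  have "?D summable_on fibre (vx p)"
  proof (rule nonneg_bdd_above_summable_on)
    have "sum ?D F' \<le> 2" if F': "F' \<subseteq> fibre (vx p)" "finite F'" for F'
    proof -
      obtain F where F: "F \<subseteq> V" "finite F" "F' = pair_arr p ` F"
        using finite_subset_image[OF F'(2), of "pair_arr p" V] F'(1) pair_arr_image[OF p] by metis
      have "sum ?D F' \<le> (\<Sum>v\<in>F. base_mass (g <# p) v + base_mass p v)"
        unfolding F(3) sumD[OF F(1)] using base_mass_nonneg[OF p] base_mass_nonneg[OF q] by (intro sum_mono) (simp add: abs_le_iff)
      also have "\<dots> \<le> 2" using sum_base_mass_le[OF p F(2,1)] sum_base_mass_le[OF q F(2,1)] by (simp add: sum.distrib)
      finally show ?thesis .
    qed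
    then show "bdd_above (sum ?D ` {F. F \<subseteq> fibre (vx p) \<and> finite F})"
      by (intro bdd_aboveI[of _ 2]) auto
  qed simp
  then have "sum ?D (pair_arr p ` F) \<le> infsum ?D (fibre (vx p))"
    using F pair_arr_image[OF p] by (intro finite_sum_le_infsum) auto
  also have "\<dots> < e" by (rule m_inv[OF vx_GH0[OF p] g])
  finally show ?thesis using sumD F by simp
qed

lemma repr:
  assumes "p \<in> V" shows "repr p \<in> X0" "repr p N = vx p N" "agree N (lim_stab (repr p)) (stab p)"
proof -
  have "repr p \<in> X0 \<and> repr p N = vx p N"
    unfolding repr_def by (rule someI[of _ "vx p"]) (simp add: vx_GH0 assms)
  then show "repr p \<in> X0" "repr p N = vx p N" "agree N (lim_stab (repr p)) (stab p)"
    using GH0_coord_iff[OF _ vx_GH0[OF assms]] lim_stab_vx[OF assms] by auto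
qed

lemma near_mass_eval:
  assumes p: "p \<in> V" and g: "g \<in> wball R"
  shows "near_mass p (g <# p) = m (repr p) (arr (repr p) g)"
  using g arr_sect[OF repr(1)[OF p] p repr(3)[OF p] RN g] by (simp add: near_mass_def)

lemma near_mass_nonneg: "p \<in> V \<Longrightarrow> near_mass p v \<ge> 0"
  by (simp add: near_mass_def m_nonneg repr)

lemma near_mass_local:
  assumes p: "p \<in> V" "q \<in> V" and ag: "agree N (stab p) (stab q)" and g: "g \<in> wball N"
  shows "near_mass q (g <# q) = near_mass p (g <# p)"
proof -
  \<comment> \<open>\<open>repr\<close> depends on \<open>p\<close> only through its ball class at
    level \<open>N\<close>, so both choices are the same unit.\<close>
  have eq: "repr q = repr p"
    using ball_class_eq_iff[OF p, of N] ag by (simp add: repr_def vx_def)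
  have iff: "g <# p = h <# p \<longleftrightarrow> g <# q = h <# q" if "h \<in> wball R" for h
    by (rule act_eq_agree[OF ag p g that]) (use RN in simp)
  show ?thesis
  proof (cases "\<exists>h\<in>wball R. g <# p = h <# p")
    case True
    then obtain h where h: "h \<in> wball R" "g <# p = h <# p" by blast
    then have "g <# q = h <# q" using iff by blast
    then show ?thesis using h near_mass_eval p eq by simp
  next
    case False
    then have "g <# p \<notin> gball R p" "g <# q \<notin> gball R q" using iff by auto
    then show ?thesis by (simp add: near_mass_def)
  qed
qed

text \<open>Both totals are the mass that \<open>m (repr p)\<close> gives to the arrows of length at
  most \<open>R\<close>, read off on two different balls.\<close>

lemma total_local:
  assumes p: "p \<in> V" "q \<in> V" and ag: "agree N (stab p) (stab q)"
  shows "total q = total p"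
proof -
  have "agree N (lim_stab (repr p)) (stab q)" using repr(3)[OF p(1)] ag agree_trans by blast
  then have 1: "agree R (lim_stab (repr p)) (stab q)" "agree R (lim_stab (repr p)) (stab p)"
    using repr(3)[OF p(1)] agree_mono RN by blast+
  have "sum (m (repr p)) (arr (repr p) ` wball R) = total p"
    unfolding total_def by (rule sum_arr_gball[OF repr(1)[OF p(1)] p(1) 1(2)]) (simp add: near_mass_eval p)
  moreover have "sum (m (repr p)) (arr (repr p) ` wball R) = total q"
    unfolding total_def
  proof (rule sum_arr_gball[OF repr(1)[OF p(1)] p(2) 1(1)])
    fix g assume g: "g \<in> wball R"
    then have "g \<in> wball N" using RN by (rule wball_mono)
    then show "m (repr p) (arr (repr p) g) = near_mass q (g <# q)"
      using near_mass_local[OF p ag] near_mass_eval[OF p(1) g] by simp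
  qed
  ultimately show ?thesis by simp
qed

lemma sum_near_base_mass:
  assumes p: "p \<in> V" shows "(\<Sum>v\<in>gball R p. \<bar>near_mass p v - base_mass p v\<bar>) \<le> d"
proof -
  let ?k = "d / real (card (wball R))"
  have "(\<Sum>v\<in>gball R p. \<bar>near_mass p v - base_mass p v\<bar>) \<le> real (card (gball R p)) * ?k"
  proof (rule sum_bounded_above)
    fix v assume "v \<in> gball R p"
    then obtain g where g: "g \<in> wball R" "v = g <# p" by blast
    have "base_mass p v = m (vx p) (arr (vx p) g)"
      unfolding base_mass_def using g p wball_carrier by (subst pair_arr_eq[of _ _ g]) auto
    then show "\<bar>near_mass p v - base_mass p v\<bar> \<le> ?k"
      using unif[OF g(1) vx_GH0[OF p] repr(1,2)[OF p]] near_mass_eval[OF p g(1)] g(2) by simp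
  qed
  also have "\<dots> \<le> real (card (wball R)) * ?k"
    using d(1) card_image_le[OF finite_wball] by (intro mult_right_mono) auto
  also have "\<dots> = d" using card_wball_pos by simp
  finally show ?thesis .
qed

text \<open>The ball carries base mass between \<open>1 - d\<close> and \<open>1\<close>, and
  freezing changes it by at most \<open>d\<close>.\<close>

lemma total_bound:
  assumes p: "p \<in> V" shows "\<bar>1 - total p\<bar> \<le> 2 * d"
proof -
  have "\<bar>total p - sum (base_mass p) (gball R p)\<bar> \<le> (\<Sum>v\<in>gball R p. \<bar>near_mass p v - base_mass p v\<bar>)"
    unfolding total_def sum_subtractf[symmetric] by (rule sum_abs)
  then show ?thesis
    using sum_near_base_mass[OF p] sum_base_mass_gball[OF p] sum_base_mass_le[OF p finite_gball gball_V[OF p, of R]] by linarith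
qed

lemma total_pos: "p \<in> V \<Longrightarrow> total p > 0"
  using total_bound[of p] d by linarith

text \<open>Three errors add up: \<open>2 * d\<close> from normalising, \<open>d\<close> from
  freezing, and \<open>d\<close> from the base mass outside the ball.\<close>

lemma sum_normalised_base_mass:
  assumes p: "p \<in> V" and F: "finite F" "F \<subseteq> V" "gball R p \<subseteq> F"
  shows "(\<Sum>v\<in>F. \<bar>near_mass p v / total p - base_mass p v\<bar>) \<le> 4 * d"
proof -
  let ?B = "gball R p"
  have "(\<Sum>v\<in>?B. \<bar>near_mass p v / total p - near_mass p v\<bar>) = (\<Sum>v\<in>?B. near_mass p v * \<bar>1 / total p - 1\<bar>)"
  proof (rule sum.cong[OF refl])
    fix v
    have "near_mass p v / total p - near_mass p v = near_mass p v * (1 / total p - 1)" by (simp add: algebra_simps)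
    then show "\<bar>near_mass p v / total p - near_mass p v\<bar> = near_mass p v * \<bar>1 / total p - 1\<bar>" using near_mass_nonneg[OF p] by (simp add: abs_mult)
  qed
  also have "\<dots> = total p * \<bar>1 / total p - 1\<bar>" by (simp add: total_def sum_distrib_right)
  also have "\<dots> = \<bar>total p * (1 / total p - 1)\<bar>" using total_pos[OF p] by (simp add: abs_mult)
  also have "\<dots> = \<bar>1 - total p\<bar>" using total_pos[OF p] by (simp add: algebra_simps)
  finally have 1: "(\<Sum>v\<in>?B. \<bar>near_mass p v / total p - near_mass p v\<bar>) \<le> 2 * d" using total_bound[OF p] by simp
  have "(\<Sum>v\<in>?B. \<bar>near_mass p v / total p - base_mass p v\<bar>) \<le> (\<Sum>v\<in>?B. \<bar>near_mass p v / total p - near_mass p v\<bar> + \<bar>near_mass p v - base_mass p v\<bar>)"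
    by (intro sum_mono) linarith
  then have 2: "(\<Sum>v\<in>?B. \<bar>near_mass p v / total p - base_mass p v\<bar>) \<le> 3 * d"
    using 1 sum_near_base_mass[OF p] by (simp add: sum.distrib)
  have "(\<Sum>v\<in>F - ?B. \<bar>near_mass p v / total p - base_mass p v\<bar>) = sum (base_mass p) (F - ?B)"
    using base_mass_nonneg[OF p] by (intro sum.cong) (auto simp: near_mass_def)
  also have "\<dots> = sum (base_mass p) F - sum (base_mass p) ?B" using F by (simp add: sum_diff)
  also have "\<dots> \<le> d" using sum_base_mass_gball[OF p] sum_base_mass_le[OF p F(1,2)] by linarith
  finally have "(\<Sum>v\<in>F - ?B. \<bar>near_mass p v / total p - base_mass p v\<bar>) \<le> d" .
  then show ?thesis using 2 sum.subset_diff[OF F(3,1), of "\<lambda>v. \<bar>near_mass p v / total p - base_mass p v\<bar>"] by linarith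
qed

lemma \<rho>_supp: "\<rho> p v \<noteq> 0 \<Longrightarrow> v \<in> gball R p"
  by (auto simp: \<rho>_def near_mass_def split: if_splits)

lemma \<rho>_norm:
  assumes p: "p \<in> V" shows "l2norm (\<rho> p) = 1"
proof -
  have "l2norm (\<rho> p) = L2_set (\<rho> p) (gball R p)"
    by (rule l2norm_finite) (use \<rho>_supp in auto)
  also have "\<dots> = sqrt (\<Sum>v\<in>gball R p. near_mass p v / total p)"
    unfolding L2_set_def \<rho>_def using near_mass_nonneg[OF p] total_pos[OF p] by simp
  also have "\<dots> = 1" using total_pos[OF p] by (simp add: total_def flip: sum_divide_distrib)
  finally show ?thesis .
qed

lemma \<rho>_local:
  assumes "p \<in> V" "q \<in> V" "agree N (stab p) (stab q)" "g \<in> wball N"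
  shows "\<rho> q (g <# q) = \<rho> p (g <# p)"
  unfolding \<rho>_def using near_mass_local[OF assms] total_local[OF assms(1-3)] by simp

text \<open>Both normalised densities are compared with the base masses, which are nearly invariant;
  each comparison costs \<open>4 * d\<close>. The square root inequality turns this l1 bound into a
  bound on the squared l2 norm.\<close>

lemma \<rho>_variation:
  assumes p: "p \<in> V" and g: "g \<in> wball n"
  shows "(l2norm (\<lambda>v. \<rho> p v - \<rho> (g <# p) v))\<^sup>2 \<le> e + 8 * d"
proof -
  let ?q = "g <# p"
  have q: "?q \<in> V" using p wball_carrier[OF g] by auto
  define F where "F = gball R p \<union> gball R ?q"
  have F: "finite F" "F \<subseteq> V" "gball R p \<subseteq> F" "gball R ?q \<subseteq> F"
    using gball_V[OF p, of R] gball_V[OF q, of R] by (auto simp: F_def finite_wball)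
  have "l2norm (\<lambda>v. \<rho> p v - \<rho> ?q v) = L2_set (\<lambda>v. \<rho> p v - \<rho> ?q v) F"
  proof (rule l2norm_finite[OF F(1)])
    fix v assume "v \<notin> F"
    then have "v \<notin> gball R p" "v \<notin> gball R ?q" using F(3,4) by blast+
    then have "\<rho> p v = 0" "\<rho> ?q v = 0" using \<rho>_supp by blast+
    then show "\<rho> p v - \<rho> ?q v = 0" by simp
  qed
  then have "(l2norm (\<lambda>v. \<rho> p v - \<rho> ?q v))\<^sup>2 = (\<Sum>v\<in>F. (\<rho> p v - \<rho> ?q v)\<^sup>2)"
    by (simp add: L2_set_def sum_nonneg)
  also have "\<dots> \<le> (\<Sum>v\<in>F. \<bar>near_mass p v / total p - near_mass ?q v / total ?q\<bar>)"
    unfolding \<rho>_def using near_mass_nonneg[OF p] near_mass_nonneg[OF q] total_pos[OF p] total_pos[OF q]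
    by (intro sum_mono sqrt_diff_square_le) auto
  also have "\<dots> \<le> (\<Sum>v\<in>F. \<bar>near_mass p v / total p - base_mass p v\<bar> + \<bar>near_mass ?q v / total ?q - base_mass ?q v\<bar> + \<bar>base_mass ?q v - base_mass p v\<bar>)"
    by (intro sum_mono) linarith
  also have "\<dots> \<le> 4 * d + 4 * d + e"
    unfolding sum.distrib
    by (intro add_mono sum_normalised_base_mass[OF p F(1,2,3)] sum_normalised_base_mass[OF q F(1,2,4)] base_mass_invariant[OF p g F(1,2)])
  finally show ?thesis by simp
qed


end

context schreier begin

lemma amenable_imp_property_A_at:
  assumes A: "GH_top_amenable G Q H" and n: "n \<ge> 1"
  shows "\<exists>\<rho>. property_A_at n \<rho>"
proof -
  \<comment> \<open>The variation bound \<open>e + 8 * d\<close> is to equal the square of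
    \<open>1 / n\<close>; each summand takes half.\<close>
  define e where "e = 1 / (2 * (real n)\<^sup>2)"
  define d where "d = 1 / (16 * (real n)\<^sup>2)"
  have n2: "(real n)\<^sup>2 \<ge> 1" using n by simp
  have e: "e > 0" and d: "d > 0" "d \<le> 1 / 4" and ed: "e + 8 * d = (1 / real n)\<^sup>2"
    using n2 n unfolding e_def d_def by (auto simp: field_simps power2_eq_square)
  obtain m where m: "(\<forall>x\<in>topspace XT. (\<forall>g. 0 \<le> m x g) \<and> (\<forall>g. m x g \<noteq> 0 \<longrightarrow> g \<in> topspace GT \<and> GH_r g = x) \<and>
               (m x has_sum 1) (fibre x)) \<and>
         (\<forall>f. continuous_map GT euclideanreal f \<and>
              compactin GT (GT closure_of {g \<in> topspace GT. f g \<noteq> 0}) \<longrightarrow>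
              continuous_map XT euclideanreal (\<lambda>x. \<Sum>\<^sub>\<infinity>g\<in>fibre x. f g * m x g)) \<and>
         (\<forall>\<gamma>\<in>tube n. (\<Sum>\<^sub>\<infinity>h\<in>fibre (GH_r \<gamma>).
             \<bar>m (GH_s G Q H \<gamma>) (GH_mult G (GH_inv G Q H \<gamma>) h) - m (GH_r \<gamma>) h\<bar>) < e)"
    using A[unfolded GH_top_amenable_def top_amenable_def, THEN spec, THEN spec, THEN mp,
        OF conjI[OF compactin_tube e]] by (rule exE)
  have m1: "m x a \<ge> 0" "(m x has_sum 1) (fibre x)" if "x \<in> X0" for x a
    using conjunct1[OF m] that unfolding topspace_XT by blast+
  have mc: "continuous_map XT euclideanreal (\<lambda>x. m x (arr x g))" if "g \<in> carrier G" for g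
    by (rule density_continuous[OF _ that]) (use conjunct1[OF conjunct2[OF m]] in blast)
  have m2: "(\<Sum>\<^sub>\<infinity>h\<in>fibre x. \<bar>m (GH_act G Q H g x) (GH_mult G (GH_inv G Q H (arr x g)) h) - m x h\<bar>) < e"
    if "x \<in> X0" "g \<in> wball n" for x g
  proof -
    have "arr x g \<in> tube n" using that by (auto simp: tube_eq)
    from conjunct2[OF conjunct2[OF m], THEN bspec, OF this] show ?thesis
      using that wball_carrier by (simp add: GH_s_arr)
  qed
  obtain R where R: "\<And>x. x \<in> X0 \<Longrightarrow> sum (m x) (arr x ` wball R) > 1 - d"
    using fibre_mass_tight[OF m1 mc d(1)] by blast
  have "d / real (card (wball R)) > 0"
    using d card_wball_pos by simp
  \<comment> \<open>The level must reach the truncation radius \<open>R\<close>, and it must be at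
    least \<open>1\<close> to serve as a positive locality radius.\<close>
  then have "\<exists>N\<ge>max 1 R. \<forall>g\<in>wball R. \<forall>x\<in>X0. \<forall>y\<in>X0. y N = x N \<longrightarrow>
      \<bar>m y (arr y g) - m x (arr x g)\<bar> < d / real (card (wball R))"
    by (intro XT_continuous_uniform_finite[where h = "\<lambda>g x. m x (arr x g)"] finite_wball mc)
      (rule wball_carrier)
  then obtain N where N: "N \<ge> max 1 R" "\<And>g x y. \<lbrakk>g \<in> wball R; x \<in> X0; y \<in> X0; y N = x N\<rbrakk> \<Longrightarrow>
      \<bar>m y (arr y g) - m x (arr x g)\<bar> < d / real (card (wball R))"
    by blast
  interpret truncated_mean G Q H m n R N d e
    by unfold_locales (use m1 m2 R N d in auto)
  have sub: "gball R p \<subseteq> gball N p" for p using wball_mono[OF _ RN] by blast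
  have sb: "sball G Q H (real N) p = gball N p" if "p \<in> V" for p
    using sball_eq[OF that, of "real N"] by simp
  show ?thesis
    unfolding property_A_at_def
  proof (rule exI[of _ \<rho>], intro conjI ballI allI impI exI[of _ "real N"])
    show "v \<in> V" if "x \<in> V" "\<rho> x v \<noteq> 0" for x v
      using \<rho>_supp[OF that(2)] gball_V[OF that(1)] by blast
    show "l2norm (\<rho> x) = 1" if "x \<in> V" for x using that by (rule \<rho>_norm)
    show "real N > 0" using N(1) by simp
    show "v \<in> sball G Q H (real N) x" if "x \<in> V" "\<rho> x v \<noteq> 0" for x v
      using \<rho>_supp[OF that(2)] sub sb[OF that(1)] by blast
  next
    fix x y assume xy: "x \<in> V" "y \<in> V" "sdist G Q x y \<le> n"
    then obtain g where g: "g \<in> wball n" "y = g <# x" using sdist_le_iff by blast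
    have "(l2norm (\<lambda>v. \<rho> x v - \<rho> y v))\<^sup>2 \<le> (1 / real n)\<^sup>2"
      using \<rho>_variation[OF xy(1) g(1)] g(2) ed by simp
    then show "l2norm (\<lambda>v. \<rho> x v - \<rho> y v) \<le> 1 / real n" by (rule power2_le_imp_le) simp
  next
    fix x y \<theta> v assume *: "x \<in> V" "y \<in> V" "rl_iso G Q H (real N) x y \<theta>" "v \<in> sball G Q H (real N) x"
    then obtain g where g: "g \<in> wball N" "v = g <# x" using sb by auto
    have "agree N (stab x) (stab y)" using rl_iso_imp_agree[OF *(1,2) _ *(3)] by simp
    moreover have "\<theta> v = g <# y" using rl_iso_act[OF *(1,2) _ *(3)] g by simp
    ultimately show "\<rho> y (\<theta> v) = \<rho> x v" using \<rho>_local[OF *(1,2) _ g(1)] g(2) by simp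
  qed
qed

lemma amenable_imp_property_A:
  assumes A: "GH_top_amenable G Q H"
  shows "local_property_A G Q H"
proof -
  \<comment> \<open>The guard under the quantifier lets choice yield one family indexed by all
    \<open>n\<close>.\<close>
  have "\<exists>\<rho>. n \<ge> 1 \<longrightarrow> property_A_at n \<rho>" for n
    using amenable_imp_property_A_at[OF A] by blast
  then show ?thesis unfolding local_property_A_iff by metis
qed

end

theorem theorem5p3:
  fixes G :: "'a monoid" and Q :: "'a set" and Z :: "'a set set" and H :: "'a set"
  assumes "group G"
    and "finite Q" and "Q \<subseteq> carrier G" and "\<forall>q\<in>Q. inv\<^bsub>G\<^esub> q \<in> Q"
    and "generate G Q = carrier G"
    and "is_URS G Z" and "H \<in> Z"
  shows "local_property_A G Q H \<longleftrightarrow> GH_top_amenable G Q H"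
proof -
  have "subgroup H G" using assms by (auto simp: is_URS_def)
  then interpret schreier G Q H
    using assms by (intro schreier.intro schreier_axioms.intro)
  show ?thesis using property_A_imp_amenable amenable_imp_property_A by blast
qed

end
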